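(* Let $\ell\geq 3$ and $s\in\mathbb{N}_0$. Then, for $0<y<v$ (where $z=x+iy$, $\tau=u+iv$), \[ F_{\ell,s}(q) = i^\ell (q)^{\ell^2-2\ell}_{\infty} q^{-h_s-\frac{\ell}{8}}\sum_{\substack{1\leq j \leq \ell \\ j\equiv \ell\pmod{2}}} \frac{D_{-j}(\tau)}{(j-1)!}\sum_{n= 0}^\infty(-1)^{n\ell}\left(\ell n+\frac{\ell}{2}-s\right)^{j-1}q^{\frac{1}{2\ell}\left(\ell n+\frac{\ell}{2}-s\right)^2}, \] where the $D_{-j}(\tau)$ are determined by the Laurent expansion around $z=0$ \[ g_\ell(z;\tau) = \sum_{j = 1}^\ell \frac{D_{-j}(\tau)}{(2\pi i z)^j} + O(1),\qquad g_\ell(z;\tau):=\frac{\eta(\tau)^{3\ell}}{\vartheta(z;\tau)^\ell}. \]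
   Context: $\tau=u+iv$ lies in the upper half-plane, $q=e^{2\pi i\tau}$, $z=x+iy$, $\zeta=e^{2\pi iz}$, $(a)_\infty:=\prod_{j\ge0}(1-aq^j)$, $\eta(\tau):=q^{1/24}(q)_\infty$, $\vartheta(z;\tau):=\sum_{n\in\frac12+\mathbb Z}q^{n^2/2}e^{2\pi in(z+\frac12)}$, and $h_s:=\frac{s^2}{2\ell}+\frac s2$. Further \[ F_{\ell,s}(q) := (q)_\infty^{\ell^2-1} \operatorname{coeff}_{\zeta^s} \frac{(q)_\infty}{(\zeta)_\infty^\ell\left(\zeta^{-1}q\right)_\infty^\ell}, \] with the coefficient of $\zeta^s$ taken in the Laurent expansion valid for $0<y<v$. *)

theory Defs
  imports "HOL-Complex_Analysis.Complex_Analysis" "HOL-Library.Landau_Symbols"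
begin

text \<open>Powers \<^term>\<open>q\<close> to the \<^term>\<open>r\<close> with \<^term>\<open>q\<close> the nome of \<^term>\<open>\<tau>\<close>; for fractional \<^term>\<open>r\<close> this
  depends on \<^term>\<open>\<tau>\<close> and is not the principal branch of powr.\<close>

definition qpow :: "complex \<Rightarrow> real \<Rightarrow> complex" where
  "qpow \<tau> r = exp (2 * of_real pi * \<i> * \<tau> * of_real r)"

abbreviation nome :: "complex \<Rightarrow> complex" where
  "nome \<tau> \<equiv> exp (2 * of_real pi * \<i> * \<tau>)"

definition qpoch_inf :: "complex \<Rightarrow> complex \<Rightarrow> complex" where
  "qpoch_inf a q = (\<Prod>j. 1 - a * q ^ j)"

definition dedekind_eta :: "complex \<Rightarrow> complex" where
  "dedekind_eta \<tau> = qpow \<tau> (1 / 24) * qpoch_inf (nome \<tau>) (nome \<tau>)"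

text \<open>The summation index in the half-integers is written as \<^term>\<open>of_int n + 1 / 2\<close>.\<close>

definition jacobi_theta :: "complex \<Rightarrow> complex \<Rightarrow> complex" where
  "jacobi_theta z \<tau> =
     (\<Sum>\<^sub>\<infinity>n\<in>(UNIV :: int set).
        qpow \<tau> ((of_int n + 1 / 2)\<^sup>2 / 2) *
        exp (2 * of_real pi * \<i> * (of_int n + 1 / 2) * (z + 1 / 2)))"

definition h_exp :: "nat \<Rightarrow> nat \<Rightarrow> real" where
  "h_exp l s = (real s)\<^sup>2 / (2 * real l) + real s / 2"

text \<open>The coefficients of the (unique) Laurent series that represents \<^term>\<open>f\<close> on the
  open annulus around 0 with radii \<^term>\<open>r\<close> and \<^term>\<open>R\<close>.\<close>

definition annulus_laurent_coeff ::
    "real \<Rightarrow> real \<Rightarrow> (complex \<Rightarrow> complex) \<Rightarrow> int \<Rightarrow> complex" where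
  "annulus_laurent_coeff r R f =
     (THE a. \<forall>\<zeta>. r < norm \<zeta> \<and> norm \<zeta> < R \<longrightarrow>
        ((\<lambda>n. a n * \<zeta> powi n) has_sum f \<zeta>) UNIV)"

definition F_fun :: "nat \<Rightarrow> nat \<Rightarrow> complex \<Rightarrow> complex" where
  "F_fun l s q =
     qpoch_inf q q ^ (l\<^sup>2 - 1) *
     annulus_laurent_coeff (norm q) 1
       (\<lambda>\<zeta>. qpoch_inf q q / (qpoch_inf \<zeta> q ^ l * qpoch_inf (inverse \<zeta> * q) q ^ l)) (int s)"

text \<open>For \<^term>\<open>q = nome \<tau>\<close> the annulus in \<^const>\<open>F_fun\<close> is the strip \<^term>\<open>0 < Im z \<and> Im z < Im \<tau>\<close>.\<close>

lemma strip_iff_annulus: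
  "0 < Im z \<and> Im z < Im \<tau> \<longleftrightarrow>
     norm (nome \<tau>) < norm (nome z) \<and> norm (nome z) < 1"
  by (auto simp: norm_exp_eq_Re zero_less_mult_iff)

definition g_fun :: "nat \<Rightarrow> complex \<Rightarrow> complex \<Rightarrow> complex" where
  "g_fun l z \<tau> = dedekind_eta \<tau> ^ (3 * l) / jacobi_theta z \<tau> ^ l"

text \<open>\<^term>\<open>D_coeff l \<tau> j\<close> is the coefficient with index \<^term>\<open>-j\<close>; the convention that it
  vanishes for \<^term>\<open>j\<close> outside \<^term>\<open>{1..l}\<close> only serves to make the function unique.\<close>

definition D_coeff :: "nat \<Rightarrow> complex \<Rightarrow> nat \<Rightarrow> complex" where
  "D_coeff l \<tau> =
     (THE D. (\<forall>j. j \<notin> {1..l} \<longrightarrow> D j = 0) \<and>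
        (\<lambda>z. g_fun l z \<tau> - (\<Sum>j = 1..l. D j / (2 * of_real pi * \<i> * z) ^ j)) \<in> O[at 0](\<lambda>_. 1))"

end

theory Submission
  imports Defs "HOL-Real_Asymp.Real_Asymp"
begin

text \<open>
  Write \<open>\<theta>(\<zeta>) = (\<zeta>)\<^sub>\<infinity> (q/\<zeta>)\<^sub>\<infinity>\<close> and let \<open>a\<^sub>n\<close> be the Laurent coefficients of \<open>\<theta>(\<zeta>)^(-l)\<close> on the annulus
  \<open>|q| < |\<zeta>| < 1\<close>. Since \<open>\<theta>(q\<zeta>) = -\<theta>(\<zeta>)/\<zeta>\<close>, the coefficients on the next annulus \<open>1 < |\<zeta>| < 1/|q|\<close>
  are \<open>(-1)^l q^(n+l) a\<^sub>n\<^sub>+\<^sub>l\<close>. In the variable \<open>z\<close> with \<open>\<zeta> = e^(2\<pi>iz)\<close> both families are integrals over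
  horizontal segments of length 1, so by periodicity they differ by \<open>2\<pi>i\<close> times the residue of
  \<open>\<theta>(\<zeta>)^(-l) \<zeta>^(-n)\<close> at \<open>z = 0\<close>. The Jacobi triple product identifies \<open>\<theta>(\<zeta>)^(-l)\<close> with
  \<open>\<zeta>^(-l/2) g\<^sub>l(z)\<close> up to a constant, so the residue is a polynomial in \<open>n + l/2\<close> with coefficients
  \<open>D\<^sub>-\<^sub>j / (j-1)!\<close>; those with \<open>j\<close> of the wrong parity vanish because \<open>\<vartheta>\<close> is odd. After
  multiplication by \<open>q^((n + l/2)^2/(2l))\<close> the difference equation telescopes, and summing it from
  \<open>n = s\<close> downwards in steps of \<open>l\<close> gives the partial theta series.
\<close>

section \<open>Infinite sums\<close>

lemma tendsto_infsum_dominated: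
  fixes f :: "'a \<Rightarrow> 'b \<Rightarrow> 'c::banach"
  assumes lim: "\<And>x. x \<in> A \<Longrightarrow> (f x \<longlongrightarrow> g x) F"
    and bound: "\<And>x y. x \<in> A \<Longrightarrow> norm (f x y) \<le> M x" and "M summable_on A"
  shows "((\<lambda>y. \<Sum>\<^sub>\<infinity>x\<in>A. f x y) \<longlongrightarrow> (\<Sum>\<^sub>\<infinity>x\<in>A. g x)) F"
proof (cases "F = bot")
  case False
  have "norm (g x) \<le> M x" if "x \<in> A" for x
    by (rule tendsto_upperbound[OF tendsto_norm[OF lim[OF that]] _ False]) (simp add: bound that)
  then have "g summable_on A"
    using Infinite_Sum.abs_summable_on_comparison_test'[OF \<open>M summable_on A\<close>]
      abs_summable_summable by blast
  show ?thesis
  proof (rule swap_uniform_limit')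
    show "\<forall>\<^sub>F X in finite_subsets_at_top A. ((\<lambda>y. \<Sum>x\<in>X. f x y) \<longlongrightarrow> (\<Sum>x\<in>X. g x)) F"
      by (auto simp: eventually_finite_subsets_at_top intro!: exI[of _ "{}"] tendsto_sum lim)
    show "((\<lambda>X. \<Sum>x\<in>X. g x) \<longlongrightarrow> (\<Sum>\<^sub>\<infinity>x\<in>A. g x)) (finite_subsets_at_top A)"
      using has_sum_infsum[OF \<open>g summable_on A\<close>] by (simp add: has_sum_def)
    show "uniform_limit UNIV (\<lambda>X y. \<Sum>x\<in>X. f x y) (\<lambda>y. \<Sum>\<^sub>\<infinity>x\<in>A. f x y) (finite_subsets_at_top A)"
      by (rule Weierstrass_m_test_general) (use assms in auto)
  qed auto
qed simp

lemma summable_on_int_iff: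
  fixes f :: "int \<Rightarrow> 'a::{topological_ab_group_add, complete_uniform_space,
    uniform_topological_group_add}"
  shows "f summable_on UNIV \<longleftrightarrow>
    (\<lambda>n. f (int n)) summable_on UNIV \<and> (\<lambda>n. f (- int n)) summable_on UNIV"
proof -
  have UNIV_int: "range int \<union> range (\<lambda>n. - int n) = UNIV"
    by (metis (mono_tags, lifting) UNIV_eq_I UnI1 UnI2 int_cases2 rangeI)
  have "f summable_on UNIV \<longleftrightarrow> f summable_on range int \<and> f summable_on range (\<lambda>n. - int n)"
    using summable_on_union[of f "range int" "range (\<lambda>n. - int n)", unfolded UNIV_int]
      summable_on_subset[of f UNIV, OF _ subset_UNIV] by blast
  also have "\<dots> \<longleftrightarrow> (\<lambda>n. f (int n)) summable_on UNIV \<and> (\<lambda>n. f (- int n)) summable_on UNIV"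
    by (subst (1 2) summable_on_reindex) (auto simp: o_def inj_on_def)
  finally show ?thesis .
qed

lemma has_sum_times_Times:
  fixes f :: "'a \<Rightarrow> 'c::{real_normed_field,banach}" and g :: "'b \<Rightarrow> 'c"
  assumes f_summable: "(\<lambda>x. norm (f x)) summable_on A"
    and g_summable: "(\<lambda>y. norm (g y)) summable_on B"
  shows "((\<lambda>(x, y). f x * g y) has_sum infsum f A * infsum g B) (A \<times> B)"
proof (rule has_sum_SigmaI)
  have "(\<lambda>z. norm (case z of (x, y) \<Rightarrow> f x * g y)) summable_on A \<times> B"
    unfolding Infinite_Sum.abs_summable_on_Sigma_iff
    by (auto simp: norm_mult infsum_cmult_right' infsum_nonneg
        intro!: summable_on_cmult_right summable_on_cmult_left f_summable g_summable)
  then show "(\<lambda>(x, y). f x * g y) summable_on A \<times> B"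
    by (rule abs_summable_summable)
  show "((\<lambda>y. case (x, y) of (x, y) \<Rightarrow> f x * g y) has_sum f x * infsum g B) B" for x
    by (simp add: has_sum_cmult_right abs_summable_summable[OF g_summable])
  show "((\<lambda>x. f x * infsum g B) has_sum infsum f A * infsum g B) A"
    by (simp add: has_sum_cmult_left abs_summable_summable[OF f_summable])
qed

section \<open>The q-Pochhammer symbol\<close>

definition qpoch :: "'a::comm_ring_1 \<Rightarrow> 'a \<Rightarrow> nat \<Rightarrow> 'a" where
  "qpoch a q n = (\<Prod>j<n. 1 - a * q ^ j)"

lemma qpoch_0 [simp]: "qpoch a q 0 = 1"
  by (simp add: qpoch_def)

lemma qpoch_Suc: "qpoch a q (Suc n) = qpoch a q n * (1 - a * q ^ n)"
  by (simp add: qpoch_def)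

lemma qpoch_add: "qpoch a q (m + n) = qpoch a q m * qpoch (a * q ^ m) q n"
  by (induction n) (simp_all add: qpoch_Suc power_add mult.assoc)

lemma qpoch_Suc_left: "qpoch a q (Suc n) = (1 - a) * qpoch (a * q) q n"
  using qpoch_add[of a q 1 n] by (simp add: qpoch_Suc)

lemma Suc_choose_two: "Suc n choose 2 = n + (n choose 2)"
  by (simp add: numeral_2_eq_2)

lemma qpoch_reflect:
  fixes a q :: "'a::field"
  assumes "a \<noteq> 0" "q \<noteq> 0"
  shows "qpoch (a / q ^ n) q n = (- a) ^ n / q ^ (Suc n choose 2) * qpoch (q / a) q n"
proof (induction n)
  case (Suc n)
  have "qpoch (a / q ^ Suc n) q (Suc n) = (1 - a / q ^ Suc n) * qpoch (a / q ^ n) q n"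
    using assms by (simp add: qpoch_Suc_left)
  also have "1 - a / q ^ Suc n = - a / q ^ Suc n * (1 - q / a * q ^ n)"
    using assms by (simp add: field_simps)
  finally show ?case
    by (simp add: Suc.IH qpoch_Suc Suc_choose_two[of "Suc n"] power_add mult_ac)
qed (simp add: binomial_eq_0)

lemma convergent_prod_qpoch:
  fixes a q :: complex
  assumes "norm q < 1"
  shows "convergent_prod (\<lambda>j. 1 - a * q ^ j)"
proof (rule abs_convergent_prod_imp_convergent_prod, rule summable_imp_abs_convergent_prod)
  show "summable (\<lambda>j. norm (1 - a * q ^ j - 1))"
    using assms by (auto simp: norm_mult norm_power intro!: summable_mult summable_geometric)
qed

lemma LIMSEQ_qpoch:
  assumes "norm q < 1"
  shows "qpoch a q \<longlonglongrightarrow> qpoch_inf a q"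
  using convergent_prod_LIMSEQ[OF convergent_prod_qpoch[OF assms, of a]]
  unfolding qpoch_inf_def qpoch_def by (simp add: LIMSEQ_lessThan_iff_atMost)

lemma qpoch_inf_rec:
  assumes "norm q < 1"
  shows "qpoch_inf a q = (1 - a) * qpoch_inf (a * q) q"
proof (rule LIMSEQ_unique)
  show "(\<lambda>n. qpoch a q (Suc n)) \<longlonglongrightarrow> qpoch_inf a q"
    using LIMSEQ_qpoch[OF assms] by (rule LIMSEQ_Suc)
  show "(\<lambda>n. qpoch a q (Suc n)) \<longlonglongrightarrow> (1 - a) * qpoch_inf (a * q) q"
    unfolding qpoch_Suc_left by (intro tendsto_mult_left LIMSEQ_qpoch assms)
qed

lemma one_minus_mult_power_nonzero:
  fixes a q :: "'a::real_normed_div_algebra"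
  assumes "norm q \<le> 1" "norm a < 1"
  shows "1 - a * q ^ j \<noteq> 0"
proof -
  have "norm a * norm q ^ j \<le> norm a"
    by (intro mult_left_le power_le_one assms) auto
  with assms have "norm (a * q ^ j) < 1"
    by (simp add: norm_mult norm_power)
  then show ?thesis
    by auto
qed

lemma qpoch_nonzero:
  fixes a q :: "'a::real_normed_field"
  assumes "norm q \<le> 1" "norm a < 1"
  shows "qpoch a q n \<noteq> 0"
  using one_minus_mult_power_nonzero[OF assms] by (simp add: qpoch_def)

lemma qpoch_inf_nonzero:
  assumes "norm q < 1" "norm a < 1"
  shows "qpoch_inf a q \<noteq> 0"
  unfolding qpoch_inf_def
  by (rule prodinf_nonzero)
    (use assms convergent_prod_qpoch one_minus_mult_power_nonzero less_imp_le in blast)+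

lemma holomorphic_on_qpoch_inf [holomorphic_intros]:
  assumes "f holomorphic_on A" "norm q < 1"
  shows "(\<lambda>z. qpoch_inf (f z) q) holomorphic_on A"
proof -
  have "(\<lambda>a. qpoch_inf a q) holomorphic_on UNIV"
  proof (rule holomorphic_uniform_sequence)
    fix x :: complex
    let ?K = "cball x 1" and ?M = "norm x + 1"
    have bound: "norm (norm (1 - a * q ^ n - 1)) \<le> ?M * norm q ^ n" if "a \<in> ?K" for a n
    proof -
      have "norm a \<le> ?M"
        using that norm_triangle_ineq2[of a x] by (simp add: dist_norm norm_minus_commute)
      then show ?thesis
        by (simp add: norm_mult norm_power mult_right_mono)
    qed
    have "uniformly_convergent_on ?K (\<lambda>N a. \<Sum>n<N. norm (1 - a * q ^ n - 1))"
      by (rule Weierstrass_m_test'[OF bound])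
        (use assms(2) in \<open>auto intro!: summable_mult summable_geometric\<close>)
    then have "uniformly_convergent_on ?K (\<lambda>N a. qpoch a q N)"
      unfolding qpoch_def by (intro uniformly_convergent_on_prod') (auto intro!: continuous_intros)
    then obtain g where limit: "uniform_limit ?K (\<lambda>N a. qpoch a q N) g sequentially"
      by (auto simp: uniformly_convergent_on_def)
    have "g a = qpoch_inf a q" if "a \<in> ?K" for a
      using tendsto_uniform_limitI[OF limit that] LIMSEQ_qpoch[OF assms(2)] LIMSEQ_unique by blast
    with limit have "uniform_limit ?K (\<lambda>N a. qpoch a q N) (\<lambda>a. qpoch_inf a q) sequentially"
      by (metis (mono_tags, lifting) uniform_limit_cong')
    then show "\<exists>d>0. cball x d \<subseteq> UNIV \<and>
        uniform_limit (cball x d) (\<lambda>N a. qpoch a q N) (\<lambda>a. qpoch_inf a q) sequentially"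
      by (intro exI[of _ 1]) auto
  qed (auto simp: qpoch_def intro!: holomorphic_intros)
  from holomorphic_on_compose_gen[OF assms(1) this] show ?thesis
    by (simp add: o_def)
qed

definition theta_prod :: "complex \<Rightarrow> complex \<Rightarrow> complex" where
  "theta_prod w q = qpoch_inf w q * qpoch_inf (q / w) q"

lemma theta_prod_inverse:
  assumes "norm q < 1" "w \<noteq> 0"
  shows "theta_prod (1 / w) q = - theta_prod w q / w"
proof -
  have inverse_rec: "qpoch_inf (1 / w) q = (1 - 1 / w) * qpoch_inf (q / w) q"
    using qpoch_inf_rec[OF assms(1), of "1 / w"] by simp
  have rec: "qpoch_inf w q = (1 - w) * qpoch_inf (q * w) q"
    using qpoch_inf_rec[OF assms(1), of w] by (simp add: mult.commute)
  show ?thesis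
    unfolding theta_prod_def inverse_rec rec using assms(2) by (simp add: field_simps)
qed

lemma theta_prod_shift:
  assumes "norm q < 1" "q \<noteq> 0" "w \<noteq> 0"
  shows "theta_prod (q * w) q = - theta_prod w q / w"
  using theta_prod_inverse[OF assms(1,3)] assms(2) by (simp add: theta_prod_def mult.commute)

section \<open>Gaussian binomial coefficients\<close>

fun gauss_binom :: "'a::comm_semiring_1 \<Rightarrow> nat \<Rightarrow> nat \<Rightarrow> 'a" where
  "gauss_binom q n 0 = 1"
| "gauss_binom q 0 (Suc k) = 0"
| "gauss_binom q (Suc n) (Suc k) = gauss_binom q n k + q ^ Suc k * gauss_binom q n (Suc k)"

lemma gauss_binom_eq_0: "n < k \<Longrightarrow> gauss_binom q n k = 0"
  by (induction q n k rule: gauss_binom.induct) auto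

lemma gauss_binom_self: "gauss_binom q n n = 1"
  by (induction n) (auto simp: gauss_binom_eq_0)

lemma gauss_binom_qpoch:
  "gauss_binom q (m + k) k * (qpoch q q k * qpoch q q m) = qpoch q q (m + k)"
proof (induction "m + k" arbitrary: m k)
  case (Suc N)
  consider "k = 0" | "m = 0" | m' k' where "m = Suc m'" "k = Suc k'"
    by (metis not0_implies_Suc)
  then show ?case
  proof cases
    case 3
    let ?b = "gauss_binom q (Suc m' + k') k'" and ?b' = "gauss_binom q (m' + Suc k') (Suc k')"
    have IHs: "?b * (qpoch q q k' * qpoch q q (Suc m')) = qpoch q q N"
      "?b' * (qpoch q q (Suc k') * qpoch q q m') = qpoch q q N"
      using Suc.hyps(1)[of "Suc m'" k'] Suc.hyps(1)[of m' "Suc k'"] Suc.hyps(2) 3 by simp_all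
    have "gauss_binom q (m + k) k * (qpoch q q k * qpoch q q m) =
        (?b + q ^ Suc k' * ?b') * (qpoch q q (Suc k') * qpoch q q (Suc m'))"
      using 3 by simp
    also have "\<dots> = ?b * (qpoch q q k' * qpoch q q (Suc m')) * (1 - q ^ Suc k') +
        q ^ Suc k' * (?b' * (qpoch q q (Suc k') * qpoch q q m')) * (1 - q ^ Suc m')"
      by (simp add: qpoch_Suc algebra_simps del: gauss_binom.simps)
    also have "\<dots> = qpoch q q N * (1 - q ^ Suc (Suc (m' + k')))"
      unfolding IHs by (simp add: algebra_simps power_add)
    also have "\<dots> = qpoch q q (m + k)"
      using 3 Suc.hyps(2) by (simp add: qpoch_Suc)
    finally show ?thesis .
  qed (auto simp: gauss_binom_self)
qed simp

theorem q_binomial: "qpoch a q n = (\<Sum>k\<le>n. q ^ (k choose 2) * gauss_binom q n k * (- a) ^ k)"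
proof (induction n arbitrary: a)
  case (Suc n)
  let ?t = "\<lambda>k. q ^ (k choose 2) * gauss_binom q n k * ((- a) ^ k * q ^ k)"
  have Suc_term: "q ^ (Suc k choose 2) * gauss_binom q (Suc n) (Suc k) * (- a) ^ Suc k =
      - a * ?t k + ?t (Suc k)" for k
    by (simp add: Suc_choose_two power_add algebra_simps)
  have "(\<Sum>k\<le>Suc n. q ^ (k choose 2) * gauss_binom q (Suc n) k * (- a) ^ k) =
      1 + (\<Sum>k\<le>n. - a * ?t k + ?t (Suc k))"
    by (subst sum.atMost_Suc_shift) (simp only: Suc_term, simp add: binomial_eq_0)
  also have "\<dots> = - a * (\<Sum>k\<le>n. ?t k) + (\<Sum>k\<le>Suc n. ?t k)"
    by (subst sum.atMost_Suc_shift) (simp add: binomial_eq_0 sum_subtractf sum_distrib_left sum_negf)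
  also have "(\<Sum>k\<le>Suc n. ?t k) = (\<Sum>k\<le>n. ?t k)"
    by (simp add: gauss_binom_eq_0)
  also have "(\<Sum>k\<le>n. ?t k) = qpoch (a * q) q n"
    by (simp add: Suc.IH flip: power_mult_distrib)
  finally show ?case
    by (simp add: qpoch_Suc_left algebra_simps)
qed (simp add: binomial_eq_0)

lemma gauss_binom_eq_qpoch:
  fixes q :: "'a::real_normed_field"
  assumes "norm q < 1"
  shows "gauss_binom q (m + k) k = qpoch q q (m + k) / (qpoch q q k * qpoch q q m)"
  using gauss_binom_qpoch[of q m k] qpoch_nonzero[of q q] assms
  by (simp add: nonzero_eq_divide_eq)

lemma tendsto_gauss_binom:
  fixes q :: complex
  assumes norm_q: "norm q < 1"
    and m_at_top: "filterlim m at_top F" and k_at_top: "filterlim k at_top F"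
  shows "((\<lambda>x. gauss_binom q (m x + k x) (k x)) \<longlongrightarrow> 1 / qpoch_inf q q) F"
proof -
  note lim = filterlim_compose[OF LIMSEQ_qpoch[OF norm_q]]
  have "filterlim (\<lambda>x. m x + k x) at_top F"
    by (rule filterlim_at_top_mono[OF m_at_top]) simp
  from lim[OF this] have "((\<lambda>x. gauss_binom q (m x + k x) (k x)) \<longlongrightarrow>
      qpoch_inf q q / (qpoch_inf q q * qpoch_inf q q)) F"
    unfolding gauss_binom_eq_qpoch[OF norm_q]
    by (intro tendsto_intros lim[OF m_at_top] lim[OF k_at_top]) (simp_all add: qpoch_inf_nonzero norm_q)
  then show ?thesis
    by (simp add: qpoch_inf_nonzero norm_q)
qed

lemma gauss_binom_bounded:
  fixes q :: complex
  assumes norm_q: "norm q < 1"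
  obtains C where "\<And>n k. norm (gauss_binom q n k) \<le> C"
proof -
  note lim = LIMSEQ_qpoch[OF norm_q, of q]
  obtain K where qpoch_le: "norm (qpoch q q n) \<le> K" for n
    using convergent_imp_Bseq[OF convergentI[OF lim]] by (auto simp: Bseq_def)
  obtain L where inverse_le: "norm (inverse (qpoch q q n)) \<le> L" for n
    using convergent_imp_Bseq[OF convergentI[OF tendsto_inverse[OF lim]]]
      qpoch_inf_nonzero[OF norm_q norm_q]
    by (auto simp: Bseq_def)
  have nonneg: "0 \<le> K" "0 \<le> L"
    using order_trans[OF norm_ge_zero qpoch_le] order_trans[OF norm_ge_zero inverse_le] by blast+
  have "norm (gauss_binom q n k) \<le> K * (L * L)" for n k
  proof (cases "k \<le> n")
    case True
    then have "gauss_binom q n k = qpoch q q n * (inverse (qpoch q q k) * inverse (qpoch q q (n - k)))"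
      using gauss_binom_eq_qpoch[OF norm_q, of "n - k" k] by (simp add: field_simps)
    then show ?thesis
      using qpoch_le inverse_le nonneg
      by (auto simp: norm_mult simp del: norm_inverse intro!: mult_mono)
  qed (use nonneg in \<open>simp add: gauss_binom_eq_0\<close>)
  then show ?thesis
    using that by blast
qed

definition central_gauss_binom :: "'a::comm_semiring_1 \<Rightarrow> nat \<Rightarrow> int \<Rightarrow> 'a" where
  "central_gauss_binom q N m = (if \<bar>m\<bar> \<le> int N then gauss_binom q (2 * N) (nat (m + int N)) else 0)"

lemma LIMSEQ_central_gauss_binom:
  fixes q :: complex
  assumes "norm q < 1"
  shows "(\<lambda>N. central_gauss_binom q N m) \<longlonglongrightarrow> 1 / qpoch_inf q q"
proof -
  have shift: "filterlim (\<lambda>N. nat (int N + i)) at_top sequentially" for i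
    by (rule filterlim_at_top_mono[OF filterlim_minus_const_nat_at_top[of "nat \<bar>i\<bar>"]])
      (intro always_eventually allI, linarith)
  have "\<forall>\<^sub>F N in sequentially.
      gauss_binom q (nat (int N + - m) + nat (int N + m)) (nat (int N + m)) =
      central_gauss_binom q N m"
    using eventually_ge_at_top[of "nat \<bar>m\<bar>"]
  proof eventually_elim
    case (elim N)
    then have "\<bar>m\<bar> \<le> int N" "nat (int N + - m) + nat (int N + m) = 2 * N"
      by linarith+
    then show ?case
      by (simp only: central_gauss_binom_def if_True add.commute[of m])
  qed
  then show ?thesis
    using tendsto_cong tendsto_gauss_binom[OF assms shift shift] by fast
qed

section \<open>The Jacobi triple product\<close>

definition theta_term :: "'a::field \<Rightarrow> 'a \<Rightarrow> int \<Rightarrow> 'a" where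
  "theta_term q w m = q powi (m * (m - 1) div 2) * (- w) powi m"

lemma triangular_number_diff:
  "(int k - int n) * (int k - int n - 1) div 2 = int (k choose 2) + int (Suc n choose 2) - int (n * k)"
proof -
  have double: "2 * int (i choose 2) = int i * (int i - 1)" for i
    by (induction i) (simp_all add: Suc_choose_two algebra_simps numeral_2_eq_2)
  have "(int k - int n) * (int k - int n - 1) =
      2 * (int (k choose 2) + int (Suc n choose 2) - int (n * k))"
    unfolding distrib_left right_diff_distrib double by (simp add: algebra_simps)
  then show ?thesis
    by simp
qed

lemma theta_term_diff:
  assumes "q \<noteq> 0" "w \<noteq> 0"
  shows "(- w) ^ n / q ^ (Suc n choose 2) * theta_term q w (int k - int n) =
    q ^ (k choose 2) * (- (w / q ^ n)) ^ k"
proof -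
  have "theta_term q w (int k - int n) =
      q ^ (k choose 2) * q ^ (Suc n choose 2) / q ^ (n * k) * ((- w) ^ k / (- w) ^ n)"
    unfolding theta_term_def triangular_number_diff using assms
    by (simp only: power_int_add power_int_diff power_int_of_nat neg_equal_0_iff_equal simp_thms)
  moreover have "(- (w / q ^ n)) ^ k = (- w) ^ k / q ^ (n * k)"
    by (simp only: minus_divide_left power_divide power_mult)
  ultimately show ?thesis
    using assms by simp
qed

lemma jacobi_triple_product_finite:
  fixes q w :: "'a::field"
  assumes "q \<noteq> 0" "w \<noteq> 0"
  shows "(\<Sum>m = - int N..int N. central_gauss_binom q N m * theta_term q w m) =
    qpoch w q N * qpoch (q / w) q N"
proof -
  let ?C = "(- w) ^ N / q ^ (Suc N choose 2)"
  have "?C * (\<Sum>m = - int N..int N. central_gauss_binom q N m * theta_term q w m) =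
      ?C * (\<Sum>k\<le>2 * N. gauss_binom q (2 * N) k * theta_term q w (int k - int N))"
    by (intro arg_cong[of _ _ "(*) ?C"]
        sum.reindex_bij_witness[of _ "\<lambda>k. int k - int N" "\<lambda>m. nat (m + int N)"])
      (auto simp: central_gauss_binom_def)
  also have "\<dots> = (\<Sum>k\<le>2 * N. gauss_binom q (2 * N) k * (?C * theta_term q w (int k - int N)))"
    unfolding sum_distrib_left by (intro sum.cong refl) (simp only: mult_ac)
  also have "\<dots> = qpoch (w / q ^ N) q (N + N)"
    unfolding theta_term_diff[OF assms] q_binomial mult_2 by (simp only: mult_ac)
  also have "\<dots> = ?C * (qpoch w q N * qpoch (q / w) q N)"
    unfolding qpoch_add qpoch_reflect[OF assms(2,1)] using assms by simp
  finally show ?thesis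
    using assms by simp
qed

lemma summable_power_choose_two:
  fixes q w :: "'a::{real_normed_field,banach}"
  assumes "norm q < 1"
  shows "summable (\<lambda>n. norm (q ^ (n choose 2) * w ^ n))"
proof -
  have "(\<lambda>n. norm w * norm q ^ n) \<longlonglongrightarrow> norm w * 0"
    using assms by (intro tendsto_mult_left LIMSEQ_power_zero) simp
  then have "\<forall>\<^sub>F n in sequentially. norm w * norm q ^ n < 1 / 2"
    by (rule order_tendstoD) simp
  then obtain N where ratio: "norm w * norm q ^ n < 1 / 2" if "n \<ge> N" for n
    by (auto simp: eventually_sequentially)
  show ?thesis
  proof (rule summable_ratio_test)
    fix n assume "n \<ge> N"
    have "norm (q ^ (Suc n choose 2) * w ^ Suc n) =
        norm w * norm q ^ n * norm (q ^ (n choose 2) * w ^ n)"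
      by (simp add: Suc_choose_two norm_mult norm_power power_add)
    also have "\<dots> \<le> 1 / 2 * norm (q ^ (n choose 2) * w ^ n)"
      by (intro mult_right_mono less_imp_le ratio \<open>n \<ge> N\<close> norm_ge_zero)
    finally show "norm (norm (q ^ (Suc n choose 2) * w ^ Suc n)) \<le>
        1 / 2 * norm (norm (q ^ (n choose 2) * w ^ n))"
      by simp
  qed simp
qed

lemma abs_summable_on_theta_term:
  fixes q w :: complex
  assumes "norm q < 1" "q \<noteq> 0" "w \<noteq> 0"
  shows "(\<lambda>m. norm (theta_term q w m)) summable_on UNIV"
proof -
  have summable: "(\<lambda>n. norm (q ^ (n choose 2) * x ^ n)) summable_on UNIV" for x
    using summable_power_choose_two[OF assms(1)] by (intro norm_summable_imp_summable_on) simp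
  have "theta_term q w (int n) = q ^ (n choose 2) * (- w) ^ n" for n
    using theta_term_diff[OF assms(2,3), of 0 n] by (simp add: binomial_eq_0)
  moreover have "theta_term q w (- int n) = q ^ (n choose 2) * (q / - w) ^ n" for n
  proof -
    have "(- w) ^ n / q ^ (Suc n choose 2) * theta_term q w (- int n) = 1"
      using theta_term_diff[OF assms(2,3), of n 0] by (simp add: binomial_eq_0)
    then have "theta_term q w (- int n) = q ^ (Suc n choose 2) / (- w) ^ n"
      using assms by (simp add: divide_eq_eq eq_divide_eq mult.commute)
    then show ?thesis
      by (simp add: Suc_choose_two power_add power_divide del: divide_minus_right)
  qed
  ultimately show ?thesis
    unfolding summable_on_int_iff using summable by simp
qed

theorem jacobi_triple_product:
  fixes q w :: complex
  assumes "norm q < 1" "q \<noteq> 0" "w \<noteq> 0"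
  shows "(theta_term q w has_sum (qpoch_inf q q * theta_prod w q)) UNIV"
proof -
  let ?t = "theta_term q w"
  obtain C where gauss_binom_le: "\<And>n k. norm (gauss_binom q n k) \<le> C"
    using gauss_binom_bounded[OF assms(1)] by blast
  have bound: "norm (central_gauss_binom q N m) \<le> C" for m N
    using gauss_binom_le order_trans[OF norm_ge_zero gauss_binom_le]
    by (simp add: central_gauss_binom_def)
  have abs_summable: "(\<lambda>m. norm (?t m)) summable_on UNIV"
    using assms by (rule abs_summable_on_theta_term)
  have partial: "(\<Sum>\<^sub>\<infinity>m. central_gauss_binom q N m * ?t m) = qpoch w q N * qpoch (q / w) q N" for N
    unfolding jacobi_triple_product_finite[OF assms(2,3), symmetric]
    by (intro infsumI has_sum_finite_neutralI[where B = "{- int N..int N}"])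
      (auto simp: central_gauss_binom_def)
  have "(\<Sum>\<^sub>\<infinity>m. 1 / qpoch_inf q q * ?t m) = theta_prod w q"
  proof (rule LIMSEQ_unique)
    show "(\<lambda>N. \<Sum>\<^sub>\<infinity>m. central_gauss_binom q N m * ?t m) \<longlonglongrightarrow> (\<Sum>\<^sub>\<infinity>m. 1 / qpoch_inf q q * ?t m)"
    proof (rule tendsto_infsum_dominated)
      show "norm (central_gauss_binom q N m * ?t m) \<le> C * norm (?t m)" for m N
        by (simp add: norm_mult mult_right_mono bound)
    qed (intro tendsto_mult_right LIMSEQ_central_gauss_binom assms(1)
        summable_on_cmult_right abs_summable)+
    show "(\<lambda>N. \<Sum>\<^sub>\<infinity>m. central_gauss_binom q N m * ?t m) \<longlonglongrightarrow> theta_prod w q"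
      unfolding partial theta_prod_def by (intro tendsto_mult LIMSEQ_qpoch assms)
  qed
  then have "1 / qpoch_inf q q * infsum ?t UNIV = theta_prod w q"
    by (simp only: infsum_cmult_right')
  then have "infsum ?t UNIV = qpoch_inf q q * theta_prod w q"
    using qpoch_inf_nonzero[OF assms(1,1)] by (simp add: field_simps)
  then show ?thesis
    using has_sum_infsum[OF abs_summable_summable[OF abs_summable]] by simp
qed

section \<open>Laurent series on an annulus\<close>

definition laurent_series_on :: "real \<Rightarrow> real \<Rightarrow> (complex \<Rightarrow> complex) \<Rightarrow> (int \<Rightarrow> complex) \<Rightarrow> bool" where
  "laurent_series_on r R f a \<longleftrightarrow>
     (\<forall>w. r < norm w \<and> norm w < R \<longrightarrow> ((\<lambda>n. a n * w powi n) has_sum f w) UNIV)"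

lemma laurent_series_onD:
  "laurent_series_on r R f a \<Longrightarrow> r < norm w \<Longrightarrow> norm w < R \<Longrightarrow>
    ((\<lambda>n. a n * w powi n) has_sum f w) UNIV"
  by (simp add: laurent_series_on_def)

lemma laurent_series_on_cong:
  assumes "laurent_series_on r R f a" "\<And>w. r < norm w \<Longrightarrow> norm w < R \<Longrightarrow> f w = g w"
  shows "laurent_series_on r R g a"
  using assms by (simp add: laurent_series_on_def)

lemma laurent_series_on_cmult:
  assumes "laurent_series_on r R f a"
  shows "laurent_series_on r R (\<lambda>w. c * f w) (\<lambda>n. c * a n)"
  unfolding laurent_series_on_def mult.assoc
  by (auto intro!: has_sum_cmult_right laurent_series_onD[OF assms])

lemma laurent_series_on_dilate:
  assumes "laurent_series_on r R f a" "c \<noteq> 0"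
  shows "laurent_series_on (r / norm c) (R / norm c) (\<lambda>w. f (c * w)) (\<lambda>n. c powi n * a n)"
  unfolding laurent_series_on_def
proof (intro allI impI)
  fix w :: complex assume "r / norm c < norm w \<and> norm w < R / norm c"
  then have "r < norm (c * w)" "norm (c * w) < R"
    using assms(2) by (simp_all add: norm_mult field_simps)
  from laurent_series_onD[OF assms(1) this]
  show "((\<lambda>n. c powi n * a n * w powi n) has_sum f (c * w)) UNIV"
    by (simp add: power_int_mult_distrib mult_ac)
qed

lemma laurent_series_on_divide_power:
  assumes "laurent_series_on r R f a" "0 \<le> r"
  shows "laurent_series_on r R (\<lambda>w. f w / w ^ k) (\<lambda>n. a (n + int k))"
  unfolding laurent_series_on_def
proof (intro allI impI)
  fix w :: complex assume annulus: "r < norm w \<and> norm w < R"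
  with assms have "((\<lambda>n. a n * w powi n / w ^ k) has_sum f w / w ^ k) UNIV"
    by (intro has_sum_divide_const laurent_series_onD) auto
  also have "?this \<longleftrightarrow> ((\<lambda>n. a (n + int k) * w powi n) has_sum f w / w ^ k) UNIV"
  proof (rule has_sum_reindex_bij_witness[of _ "\<lambda>n. n + int k" "\<lambda>n. n - int k"])
    have "w \<noteq> 0"
      using annulus assms(2) by auto
    then show "a (n - int k + int k) * w powi (n - int k) = a n * w powi n / w ^ k" for n
      by (simp add: power_int_diff)
  qed auto
  finally show "((\<lambda>n. a (n + int k) * w powi n) has_sum f w / w ^ k) UNIV" .
qed

lemma laurent_series_on_coeff_bounded:
  assumes "laurent_series_on r R f a" "r < \<rho>" "\<rho> < R" "0 < \<rho>"
  obtains C where "\<And>n. norm (a n) * \<rho> powi n \<le> C"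
proof
  fix n
  have "((\<lambda>n. a n * of_real \<rho> powi n) has_sum f (of_real \<rho>)) UNIV"
    by (rule laurent_series_onD[OF assms(1)]) (use assms in auto)
  then have "(\<lambda>n. a n * of_real \<rho> powi n) summable_on UNIV"
    by (rule has_sum_imp_summable)
  then have "(\<lambda>n. norm (a n * of_real \<rho> powi n)) summable_on UNIV"
    by (simp add: summable_on_iff_abs_summable_on_complex)
  from finite_sum_le_infsum[OF this, of "{n}"]
  have "norm (a n * of_real \<rho> powi n) \<le> (\<Sum>\<^sub>\<infinity>n. norm (a n * of_real \<rho> powi n))"
    by simp
  then show "norm (a n) * \<rho> powi n \<le> (\<Sum>\<^sub>\<infinity>n. norm (a n * of_real \<rho> powi n))"
    using assms(4) by (simp add: norm_mult norm_power_int)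
qed

lemma has_sum_laurent_times:
  fixes b c :: "nat \<Rightarrow> complex"
  assumes "w \<noteq> 0"
    and b_summable: "(\<lambda>m. norm (b m * w ^ m)) summable_on UNIV"
    and c_summable: "(\<lambda>k. norm (c k / w ^ k)) summable_on UNIV"
  shows "((\<lambda>n. (\<Sum>\<^sub>\<infinity>(m, k) | int m - int k = n. b m * c k) * w powi n)
    has_sum (\<Sum>\<^sub>\<infinity>m. b m * w ^ m) * (\<Sum>\<^sub>\<infinity>k. c k / w ^ k)) UNIV"
proof -
  let ?f = "\<lambda>(m, k). (b m * w ^ m) * (c k / w ^ k)"
  let ?A = "\<lambda>n. {(m, k). int m - int k = n}"
  have has_sum: "(?f has_sum (\<Sum>\<^sub>\<infinity>m. b m * w ^ m) * (\<Sum>\<^sub>\<infinity>k. c k / w ^ k)) (UNIV \<times> UNIV)"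
    using b_summable c_summable by (rule has_sum_times_Times)
  also have "?this \<longleftrightarrow> ((\<lambda>(n, mk). ?f mk) has_sum (\<Sum>\<^sub>\<infinity>m. b m * w ^ m) * (\<Sum>\<^sub>\<infinity>k. c k / w ^ k))
      (Sigma UNIV ?A)"
    by (rule has_sum_reindex_bij_witness[of _ snd "\<lambda>(m, k). (int m - int k, (m, k))"]) auto
  finally show ?thesis
  proof (rule has_sum_SigmaD)
    fix n
    have "infsum ?f (?A n) = (\<Sum>\<^sub>\<infinity>(m, k) | int m - int k = n. b m * c k * w powi n)"
      using \<open>w \<noteq> 0\<close> by (intro infsum_cong) (auto simp: power_int_diff)
    also have "\<dots> = (\<Sum>\<^sub>\<infinity>(m, k) | int m - int k = n. b m * c k) * w powi n"
      by (simp add: case_prod_unfold infsum_cmult_left')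
    finally show "((\<lambda>mk. case (n, mk) of (n, mk) \<Rightarrow> ?f mk) has_sum
        (\<Sum>\<^sub>\<infinity>(m, k) | int m - int k = n. b m * c k) * w powi n) (?A n)"
      using has_sum_infsum[OF summable_on_subset_banach[OF has_sum_imp_summable[OF has_sum], of "?A n"]]
      by simp
  qed
qed

lemma holomorphic_power_series_has_sum:
  assumes "f holomorphic_on ball 0 r" "norm w < r"
  shows "(\<lambda>n. norm ((deriv ^^ n) f 0 / fact n * w ^ n)) summable_on UNIV"
    and "((\<lambda>n. (deriv ^^ n) f 0 / fact n * w ^ n) has_sum f w) UNIV"
proof -
  let ?p = "\<lambda>n. (deriv ^^ n) f 0 / fact n"
  have sums: "(\<lambda>n. ?p n * x ^ n) sums f x" if "norm x < r" for x
    using holomorphic_power_series[OF assms(1)] that by simp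
  obtain t where between: "norm w < t" "t < r"
    using dense[OF assms(2)] by blast
  then have norm_t: "norm (complex_of_real t) = t"
    using order_le_less_trans[OF norm_ge_zero between(1)] by simp
  have abs_summable: "summable (\<lambda>n. norm (?p n * w ^ n))"
    by (rule powser_insidea[OF sums_summable[OF sums], of "of_real t"]) (simp_all only: norm_t between)
  then show "(\<lambda>n. norm (?p n * w ^ n)) summable_on UNIV"
    by (rule summable_nonneg_imp_summable_on) simp
  show "((\<lambda>n. ?p n * w ^ n) has_sum f w) UNIV"
    using abs_summable sums[OF assms(2)] by (rule norm_summable_imp_has_sum)
qed

lemma laurent_series_on_product:
  assumes "f holomorphic_on ball 0 R" "g holomorphic_on ball 0 S" "0 < S"
  obtains a where "laurent_series_on (norm q / S) R (\<lambda>w. f w * g (q / w)) a"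
proof
  let ?b = "\<lambda>m. (deriv ^^ m) f 0 / fact m" and ?c = "\<lambda>k. (deriv ^^ k) g 0 / fact k * q ^ k"
  show "laurent_series_on (norm q / S) R (\<lambda>w. f w * g (q / w))
      (\<lambda>n. \<Sum>\<^sub>\<infinity>(m, k) | int m - int k = n. ?b m * ?c k)"
    unfolding laurent_series_on_def
  proof (intro allI impI)
    fix w :: complex assume annulus: "norm q / S < norm w \<and> norm w < R"
    moreover have "0 \<le> norm q / S"
      using assms(3) by simp
    ultimately have "w \<noteq> 0"
      by auto
    then have "norm (q / w) < S"
      using annulus assms(3) by (simp add: norm_divide field_simps)
    note f = holomorphic_power_series_has_sum[OF assms(1), of w]
    note g = holomorphic_power_series_has_sum[OF assms(2) \<open>norm (q / w) < S\<close>, unfolded power_divide]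
    show "((\<lambda>n. (\<Sum>\<^sub>\<infinity>(m, k) | int m - int k = n. ?b m * ?c k) * w powi n) has_sum f w * g (q / w)) UNIV"
      using has_sum_laurent_times[OF \<open>w \<noteq> 0\<close>, of ?b ?c] annulus f g infsumI[OF f(2)] infsumI[OF g(2)]
      by simp
  qed
qed

lemma has_sum_contour_integral_linepath:
  fixes T :: "'k \<Rightarrow> complex \<Rightarrow> complex"
  assumes continuous: "\<And>k. continuous_on (closed_segment u v) (T k)"
    and integral: "\<And>k. (T k has_contour_integral I k) (linepath u v)"
    and bound: "\<And>k z. z \<in> closed_segment u v \<Longrightarrow> norm (T k z) \<le> M k" "M summable_on UNIV"
    and has_sum: "\<And>z. z \<in> closed_segment u v \<Longrightarrow> ((\<lambda>k. T k z) has_sum F z) UNIV"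
    and sum_integrals: "(I has_sum S) UNIV"
  shows "(F has_contour_integral S) (linepath u v)"
proof -
  have lim: "uniform_limit (closed_segment u v) (\<lambda>X z. \<Sum>k\<in>X. T k z) F (finite_subsets_at_top UNIV)"
    using bound(1) has_sum bound(2) by (rule Weierstrass_m_test_general')
  have cont: "continuous_on (closed_segment u v) (\<lambda>z. \<Sum>k\<in>X. T k z)" for X
    by (intro continuous_on_sum continuous)
  obtain J L where partial: "\<And>X. ((\<lambda>z. \<Sum>k\<in>X. T k z) has_contour_integral J X) (linepath u v)"
    and limit: "(F has_contour_integral L) (linepath u v)" "(J \<longlongrightarrow> L) (finite_subsets_at_top UNIV)"
    using uniform_limit_contour_integral_linepath[OF lim[folded path_image_linepath]
        cont[folded path_image_linepath] finite_subsets_at_top_neq_bot] by blast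
  have "J X = sum I X" if "finite X" for X
    using has_contour_integral_unique[OF partial has_contour_integral_sum[OF that integral]] .
  then have "\<forall>\<^sub>F X in finite_subsets_at_top UNIV. J X = sum I X"
    by (auto simp: eventually_finite_subsets_at_top)
  with limit(2) have "(sum I \<longlongrightarrow> L) (finite_subsets_at_top UNIV)"
    by (simp add: tendsto_cong)
  then have "L = S"
    using sum_integrals has_sum_unique has_sum_def by blast
  with limit(1) show ?thesis
    by simp
qed

lemma norm_nome: "norm (nome z) = exp (- 2 * pi * Im z)"
  by (simp add: norm_exp_eq_Re)

lemma nome_powi: "nome z powi n = exp (2 * of_real pi * \<i> * of_int n * z)"
  by (simp add: exp_power_int mult_ac)

lemma nome_plus_one: "nome (z + 1) = nome z"
  by (simp add: distrib_left exp_add)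

lemma has_contour_integral_nome_powi:
  "((\<lambda>z. nome z powi k) has_contour_integral of_bool (k = 0)) (linepath u (u + 1))"
proof (cases "k = 0")
  case True
  then show ?thesis
    using has_contour_integral_const_linepath[of 1 "u + 1" u] by simp
next
  case False
  define c where "c = 2 * of_real pi * \<i> * of_int k"
  have "c \<noteq> 0"
    using False by (simp add: c_def)
  then have "((\<lambda>z. nome z powi k / c) has_field_derivative nome z powi k) (at z)" for z
    unfolding nome_powi c_def[symmetric] by (auto intro!: derivative_eq_intros)
  from contour_integral_primitive[of UNIV, OF this, of "linepath u (u + 1)"]
  have "((\<lambda>z. nome z powi k) has_contour_integral
      nome (u + 1) powi k / c - nome u powi k / c) (linepath u (u + 1))"
    by simp
  then show ?thesis
    unfolding nome_plus_one using False by simp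
qed

lemma laurent_series_on_contour_integral:
  assumes series: "laurent_series_on r R f a" and annulus: "r < norm (nome u)" "norm (nome u) < R"
  shows "((\<lambda>z. f (nome z) / nome z powi n) has_contour_integral a n) (linepath u (u + 1))"
proof (rule has_sum_contour_integral_linepath[where T = "\<lambda>k z. a k * nome z powi (k - n)"])
  have norm: "norm (nome z) = norm (nome u)" if "z \<in> closed_segment u (u + 1)" for z
    using that by (auto simp: norm_nome closed_segment_same_Im)
  show has_sum: "((\<lambda>k. a k * nome z powi (k - n)) has_sum f (nome z) / nome z powi n) UNIV"
    if "z \<in> closed_segment u (u + 1)" for z
    using has_sum_divide_const[OF laurent_series_onD[OF series, of "nome z"], of "nome z powi n"]
      norm[OF that] annulus by (simp add: power_int_diff)
  show "norm (a k * nome z powi (k - n)) \<le> norm (a k * nome u powi (k - n))"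
    if "z \<in> closed_segment u (u + 1)" for k z
    using norm[OF that] by (simp add: norm_mult norm_power_int)
  show "(\<lambda>k. norm (a k * nome u powi (k - n))) summable_on UNIV"
    using has_sum_imp_summable[OF has_sum[of u]]
    by (simp add: summable_on_iff_abs_summable_on_complex)
  show "((\<lambda>z. a k * nome z powi (k - n)) has_contour_integral a k * of_bool (k - n = 0))
      (linepath u (u + 1))" for k
    by (intro has_contour_integral_lmul has_contour_integral_nome_powi)
  show "((\<lambda>k. a k * of_bool (k - n = 0)) has_sum a n) UNIV"
    by (rule has_sum_finite_neutralI[of "{n}"]) auto
qed (auto intro!: continuous_intros)

lemma laurent_series_on_unique:
  assumes "laurent_series_on r R f a" "laurent_series_on r R f b" "0 \<le> r" "r < R"
  shows "a = b"
proof
  fix n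
  obtain \<rho> where \<rho>: "r < \<rho>" "\<rho> < R"
    using \<open>r < R\<close> dense by blast
  define u where "u = Complex 0 (- ln \<rho> / (2 * pi))"
  have "norm (nome u) = \<rho>"
    using \<rho> \<open>0 \<le> r\<close> by (simp add: norm_nome u_def)
  then show "a n = b n"
    using assms(1,2) \<rho>
    by (intro has_contour_integral_unique[OF laurent_series_on_contour_integral
          laurent_series_on_contour_integral]) auto
qed

lemma annulus_laurent_coeff_eqI:
  assumes "laurent_series_on r R f a" "0 \<le> r" "r < R"
  shows "annulus_laurent_coeff r R f = a"
  unfolding annulus_laurent_coeff_def laurent_series_on_def[symmetric]
  using assms by (intro the_equality laurent_series_on_unique)

section \<open>Residues and principal parts\<close>

lemma contour_integral_rectpath_residues:
  assumes domain: "open S" "connected S" "cbox a c \<subseteq> S"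
    and holo: "F holomorphic_on S - pts" "finite pts" "pts \<subseteq> box a c"
    and corners: "Re a < Re c" "Im a < Im c"
  shows "contour_integral (rectpath a c) F = 2 * of_real pi * \<i> * (\<Sum>p\<in>pts. residue F p)"
proof -
  have image: "path_image (rectpath a c) = cbox a c - box a c"
    using corners by (intro path_image_rectpath_cbox_minus_box) auto
  have "contour_integral (rectpath a c) F =
      2 * pi * \<i> * (\<Sum>p\<in>pts. winding_number (rectpath a c) p * residue F p)"
  proof (rule Residue_theorem[OF domain(1,2) holo(2,1)])
    show "\<forall>z. z \<notin> S \<longrightarrow> winding_number (rectpath a c) z = 0"
      using domain(3) corners by (auto intro!: winding_number_rectpath_outside)
  qed (use image domain(3) holo(3) in auto)
  also have "(\<Sum>p\<in>pts. winding_number (rectpath a c) p * residue F p) = (\<Sum>p\<in>pts. residue F p)"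
    using holo(3) by (intro sum.cong) (auto simp: winding_number_rectpath)
  finally show ?thesis
    by simp
qed

lemma has_contour_integral_linepath_periodic:
  assumes "\<And>z. F (z + \<omega>) = F z"
  shows "(F has_contour_integral I) (linepath (a + \<omega>) (b + \<omega>)) \<longleftrightarrow>
    (F has_contour_integral I) (linepath a b)"
proof -
  have "linepath (a + \<omega>) (b + \<omega>) = (+) \<omega> \<circ> linepath a b"
    by (auto simp: linepath_def fun_eq_iff algebra_simps)
  then show ?thesis
    by (simp add: has_contour_integral_translate assms)
qed

lemma contour_integral_periodic_rectangle:
  assumes domain: "open S" "connected S" "cbox a (d + of_real \<omega>) \<subseteq> S"
    and holo: "F holomorphic_on S - pts" "finite pts" "pts \<subseteq> box a (d + of_real \<omega>)"
    and periodic: "\<And>z. F (z + of_real \<omega>) = F z"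
    and corners: "0 < \<omega>" "Re d = Re a" "Im a < Im d"
    and bottom: "(F has_contour_integral I) (linepath a (a + of_real \<omega>))"
    and top: "(F has_contour_integral J) (linepath d (d + of_real \<omega>))"
  shows "I - J = 2 * of_real pi * \<i> * (\<Sum>p\<in>pts. residue F p)"
proof -
  let ?b = "a + of_real \<omega>" and ?c = "d + of_real \<omega>"
  have "Complex (Re ?c) (Im a) = ?b" "Complex (Re a) (Im ?c) = d"
    using corners by (simp_all add: complex_eq_iff)
  then have rect: "rectpath a ?c = linepath a ?b +++ linepath ?b ?c +++ linepath ?c d +++ linepath d a"
    by (simp only: rectpath_def Let_def)
  have "path_image (rectpath a ?c) \<subseteq> S - pts"
    using path_image_rectpath_cbox_minus_box[of a ?c] domain(3) holo(3) corners by auto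
  then have "closed_segment d a \<subseteq> S - pts"
    by (auto simp: rect path_image_join)
  then obtain K where left: "(F has_contour_integral K) (linepath d a)"
    using contour_integrable_continuous_linepath holomorphic_on_imp_continuous_on[OF holo(1)]
    by (metis continuous_on_subset contour_integrable_on_def)
  then have right: "(F has_contour_integral - K) (linepath ?b ?c)"
    using has_contour_integral_reversepath[of "linepath d a"]
    by (simp add: has_contour_integral_linepath_periodic periodic)
  have "(F has_contour_integral - J) (linepath ?c d)"
    using has_contour_integral_reversepath[OF _ top] by simp
  then have "(F has_contour_integral (I + (- K + (- J + K)))) (rectpath a ?c)"
    unfolding rect by (intro has_contour_integral_join bottom right left valid_path_join) auto
  then have "contour_integral (rectpath a ?c) F = I - J"
    using contour_integral_unique by fastforce
  moreover have "contour_integral (rectpath a ?c) F = 2 * of_real pi * \<i> * (\<Sum>p\<in>pts. residue F p)"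
    using domain holo by (rule contour_integral_rectpath_residues) (use corners in auto)
  ultimately show ?thesis
    by simp
qed

definition polar_part :: "complex \<Rightarrow> nat \<Rightarrow> (nat \<Rightarrow> complex) \<Rightarrow> complex \<Rightarrow> complex" where
  "polar_part c l D z = (\<Sum>j = 1..l. D j / (c * z) ^ j)"

lemma polar_part_0 [simp]: "polar_part c 0 D z = 0"
  by (simp add: polar_part_def)

lemma polar_part_Suc: "polar_part c (Suc l) D z = polar_part c l D z + D (Suc l) / (c * z) ^ Suc l"
  by (simp add: polar_part_def)

lemma polar_part_cong:
  "(\<And>j. j \<in> {1..l} \<Longrightarrow> D j = E j) \<Longrightarrow> polar_part c l D z = polar_part c l E z"
  by (simp add: polar_part_def)

lemma polar_part_cmult: "polar_part c l (\<lambda>j. k * D j) z = k * polar_part c l D z"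
  by (simp add: polar_part_def sum_distrib_left)

lemma polar_part_diff: "polar_part c l (\<lambda>j. D j - E j) z = polar_part c l D z - polar_part c l E z"
  by (simp add: polar_part_def diff_divide_distrib sum_subtractf)

lemma polar_part_uminus: "polar_part c l D (- z) = polar_part c l (\<lambda>j. (- 1) ^ j * D j) z"
proof -
  have "D j / (c * - z) ^ j = (- 1) ^ j * D j / (c * z) ^ j" for j
    by (cases "even j") auto
  then show ?thesis
    by (simp only: polar_part_def)
qed

lemma holomorphic_on_polar_part:
  "c \<noteq> 0 \<Longrightarrow> 0 \<notin> A \<Longrightarrow> polar_part c l D holomorphic_on A"
  unfolding polar_part_def by (intro holomorphic_intros) auto

lemma polar_part_exists:
  assumes "open S" "H holomorphic_on S" "c \<noteq> 0"
  obtains D h where "\<And>j. j \<notin> {1..l} \<Longrightarrow> D j = 0" "h holomorphic_on S"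
    "\<And>z. z \<in> S - {0} \<Longrightarrow> H z / z ^ l = polar_part c l D z + h z"
  using assms(2)
proof (induction l arbitrary: H thesis)
  case 0
  from 0(1)[of "\<lambda>_. 0" H] 0(2) show ?case
    by simp
next
  case (Suc l)
  define G where "G z = (if z = 0 then deriv H 0 else (H z - H 0) / (z - 0))" for z
  have "G holomorphic_on S"
    unfolding G_def using Suc.prems(2) assms(1) by (rule pole_lemma_open)
  then obtain D h where D_outside: "\<And>j. j \<notin> {1..l} \<Longrightarrow> D j = 0" and holo: "h holomorphic_on S"
    and expansion: "\<And>z. z \<in> S - {0} \<Longrightarrow> G z / z ^ l = polar_part c l D z + h z"
    using Suc.IH by blast
  let ?D = "D(Suc l := H 0 * c ^ Suc l)"
  show ?case
  proof (rule Suc.prems(1)[of ?D h])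
    fix z assume punctured: "z \<in> S - {0}"
    then have "H z / z ^ Suc l = H 0 / z ^ Suc l + G z / z ^ l"
      by (simp add: G_def field_simps)
    also have "G z / z ^ l = polar_part c l ?D z + h z"
      using expansion[OF punctured] polar_part_cong[of l D ?D] by simp
    also have "H 0 / z ^ Suc l = ?D (Suc l) / (c * z) ^ Suc l"
      using \<open>c \<noteq> 0\<close> by (simp add: power_mult_distrib)
    finally show "H z / z ^ Suc l = polar_part c (Suc l) ?D z + h z"
      by (simp only: polar_part_Suc add_ac)
  qed (use D_outside holo in auto)
qed

lemma tendsto_polar_part_times_power:
  assumes "c \<noteq> 0"
  shows "((\<lambda>z. polar_part c l D z * (c * z) ^ l) \<longlongrightarrow> (if l = 0 then 0 else D l)) (at 0)"
proof (induction l)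
  case (Suc l)
  have "((\<lambda>z. polar_part c l D z * (c * z) ^ l * (c * z) + D (Suc l)) \<longlongrightarrow>
      (if l = 0 then 0 else D l) * (c * 0) + D (Suc l)) (at 0)"
    by (intro tendsto_intros Suc.IH)
  moreover have "\<forall>\<^sub>F z in at 0. polar_part c l D z * (c * z) ^ l * (c * z) + D (Suc l) =
      polar_part c (Suc l) D z * (c * z) ^ Suc l"
    using eventually_neq_at_within[of 0]
    by eventually_elim (use assms in \<open>simp add: polar_part_Suc algebra_simps\<close>)
  ultimately show ?case
    by (simp add: tendsto_cong)
qed simp

lemma polar_part_bigo_1_imp_zero:
  assumes "c \<noteq> 0" "polar_part c l D \<in> O[at 0](\<lambda>_. 1)" "j \<in> {1..l}"
  shows "D j = 0"
  using assms(2,3)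
proof (induction l)
  case (Suc l)
  have "((\<lambda>z. (c * z) ^ Suc l) \<longlongrightarrow> 0) (at 0)"
    by (auto intro!: tendsto_eq_intros)
  then have "(\<lambda>z. polar_part c (Suc l) D z * (c * z) ^ Suc l) \<in> o[at 0](\<lambda>z. 1 * 1)"
    by (intro landau_o.big_small_mult[OF Suc.prems(1)] smalloI_tendsto) auto
  then have "((\<lambda>z. polar_part c (Suc l) D z * (c * z) ^ Suc l) \<longlongrightarrow> 0) (at 0)"
    by (auto dest: smalloD_tendsto)
  then have top_coeff: "D (Suc l) = 0"
    using tendsto_polar_part_times_power[OF assms(1), of "Suc l" D] tendsto_unique[OF at_neq_bot]
    by fastforce
  have "polar_part c l D \<in> O[at 0](\<lambda>_. 1)"
    using Suc.prems(1) top_coeff by (simp add: polar_part_Suc[abs_def])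
  then show ?case
    using Suc top_coeff by (cases "j = Suc l") auto
qed simp

lemma polar_part_unique:
  assumes "c \<noteq> 0"
    and first: "\<And>j. j \<notin> {1..l} \<Longrightarrow> D j = 0" "(\<lambda>z. f z - polar_part c l D z) \<in> O[at 0](\<lambda>_. 1)"
    and second: "\<And>j. j \<notin> {1..l} \<Longrightarrow> E j = 0" "(\<lambda>z. f z - polar_part c l E z) \<in> O[at 0](\<lambda>_. 1)"
  shows "D = E"
proof
  fix j
  have "(\<lambda>z. (f z - polar_part c l E z) - (f z - polar_part c l D z)) \<in> O[at 0](\<lambda>_. 1)"
    using second(2) first(2) by (rule sum_in_bigo(2))
  then have "polar_part c l (\<lambda>j. D j - E j) \<in> O[at 0](\<lambda>_. 1)"
    by (simp add: polar_part_diff[abs_def])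
  from polar_part_bigo_1_imp_zero[OF assms(1) this, of j] first(1)[of j] second(1)[of j]
  show "D j = E j"
    by (cases "j \<in> {1..l}") auto
qed

lemma bigo_1_of_holomorphic_remainder:
  assumes "open S" "x \<in> S" "h holomorphic_on S"
    and "\<And>z. z \<in> S - {x} \<Longrightarrow> f z = g z + h z"
  shows "(\<lambda>z. f z - g z) \<in> O[at x](\<lambda>_. 1)"
proof -
  have "h \<in> O[at x](\<lambda>_. 1)"
    using assms(1-3) by (intro continuous_imp_bigo_1 holomorphic_on_imp_differentiable_at
        field_differentiable_imp_continuous_at)
  also have "\<forall>\<^sub>F z in at x. z \<in> S - {x}"
    using assms(1,2) by (rule eventually_at_in_open)
  then have "\<forall>\<^sub>F z in at x. h z = f z - g z"
    by eventually_elim (use assms(4) in simp)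
  then have "h \<in> O[at x](\<lambda>_. 1) \<longleftrightarrow> (\<lambda>z. f z - g z) \<in> O[at x](\<lambda>_. 1)"
    by (rule landau_o.big.in_cong)
  finally show ?thesis .
qed

lemma bigo_uminus_at_0:
  fixes f :: "complex \<Rightarrow> complex"
  assumes "f \<in> O[at 0](\<lambda>_. 1)"
  shows "(\<lambda>z. f (- z)) \<in> O[at 0](\<lambda>_. 1)"
proof (rule landau_o.big.compose[OF assms])
  show "filterlim uminus (at 0) (at (0 :: complex))"
    by (rule filterlim_atI) (auto intro!: tendsto_eq_intros simp: eventually_at_filter)
qed

lemma residue_polar_part_exp:
  assumes "c \<noteq> 0"
  shows "residue (\<lambda>z. polar_part c l D z * exp (a * z)) 0 =
    (\<Sum>j = 1..l. D j / c ^ j * (a ^ (j - 1) / fact (j - 1)))"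
proof (induction l)
  case (Suc l)
  let ?e = "\<lambda>z. exp (a * z) / z ^ Suc l"
  have "residue (\<lambda>z. polar_part c (Suc l) D z * exp (a * z)) 0 =
      residue (\<lambda>z. polar_part c l D z * exp (a * z) + D (Suc l) / c ^ Suc l * ?e z) 0"
    by (simp add: polar_part_Suc power_mult_distrib distrib_right del: power_Suc)
  also have "\<dots> = residue (\<lambda>z. polar_part c l D z * exp (a * z)) 0 +
      residue (\<lambda>z. D (Suc l) / c ^ Suc l * ?e z) 0"
    by (rule residue_add[of UNIV])
      (use assms in \<open>auto intro!: holomorphic_intros holomorphic_on_polar_part\<close>)
  also have "residue (\<lambda>z. D (Suc l) / c ^ Suc l * ?e z) 0 = D (Suc l) / c ^ Suc l * residue ?e 0"
    by (rule residue_lmul[of UNIV]) (auto intro!: holomorphic_intros)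
  also have "residue ?e 0 = a ^ l / fact l"
    using residue_fps_expansion_over_power_at_0[OF has_fps_expansion_exp[of a], of l] by simp
  finally show ?case
    by (simp add: Suc.IH)
qed (simp add: residue_const)

lemma residue_times_exp:
  assumes domain: "open S" "0 \<in> S" and "h holomorphic_on S" "c \<noteq> 0"
    and expansion: "\<And>z. z \<in> S - {0} \<Longrightarrow> f z = polar_part c l D z + h z"
  shows "residue (\<lambda>z. f z * exp (a * z)) 0 =
    (\<Sum>j = 1..l. D j / c ^ j * (a ^ (j - 1) / fact (j - 1)))"
proof -
  have "\<forall>\<^sub>F z in at 0. z \<in> S - {0}"
    using domain by (rule eventually_at_in_open)
  then have "\<forall>\<^sub>F z in at 0. f z * exp (a * z) = polar_part c l D z * exp (a * z) + h z * exp (a * z)"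
    by eventually_elim (simp add: expansion distrib_right)
  then have "residue (\<lambda>z. f z * exp (a * z)) 0 =
      residue (\<lambda>z. polar_part c l D z * exp (a * z) + h z * exp (a * z)) 0"
    by (rule residue_cong) simp
  also have "\<dots> = residue (\<lambda>z. polar_part c l D z * exp (a * z)) 0 + residue (\<lambda>z. h z * exp (a * z)) 0"
    using domain assms(3,4)
    by (intro residue_add[of S] holomorphic_intros holomorphic_on_polar_part)
      (auto intro: holomorphic_on_subset)
  also have "residue (\<lambda>z. h z * exp (a * z)) 0 = 0"
    using domain assms(3) by (intro residue_holo[of S] holomorphic_intros)
  finally show ?thesis
    by (simp add: residue_polar_part_exp[OF \<open>c \<noteq> 0\<close>])
qed

section \<open>The theta function\<close>

lemma norm_nome_less_one: "Im \<tau> > 0 \<Longrightarrow> norm (nome \<tau>) < 1"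
  by (simp add: norm_nome)

lemma qpow_add: "qpow \<tau> (a + b) = qpow \<tau> a * qpow \<tau> b"
  by (simp add: qpow_def exp_add distrib_left)

lemma qpow_of_int: "qpow \<tau> (of_int n) = nome \<tau> powi n"
  by (simp add: qpow_def exp_power_int mult_ac)

lemma norm_qpow: "norm (qpow \<tau> r) = exp (- 2 * pi * Im \<tau> * r)"
  by (simp add: qpow_def norm_exp_eq_Re)

lemma jacobi_theta_term:
  "qpow \<tau> ((of_int n + 1 / 2)\<^sup>2 / 2) * exp (2 * of_real pi * \<i> * (of_int n + 1 / 2) * (z + 1 / 2)) =
    - \<i> * qpow \<tau> (1 / 8) * exp (- (of_real pi * \<i> * z)) * theta_term (nome \<tau>) (nome z) (n + 1)"
proof -
  have "2 * ((n + 1) * (n + 1 - 1) div 2) = (n + 1) * n"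
    by simp
  then have "2 * (of_int ((n + 1) * (n + 1 - 1) div 2) :: complex) = of_int (n + 1) * of_int n"
    by (metis of_int_mult of_int_numeral)
  then have triangular:
    "(of_int ((n + 1) * (n + 1 - 1) div 2) :: complex) = of_int (n + 1) * of_int n / 2"
    by (simp only: eq_divide_eq_numeral1 mult.commute) simp
  have "exp (\<i> * of_real pi / 2) = \<i>"
    using cis_conv_exp[of "pi / 2"] by simp
  then have minus_i: "- \<i> = exp (- (\<i> * of_real pi / 2))"
    by (simp add: exp_minus)
  have minus_nome: "- nome z = exp (\<i> * of_real pi + 2 * of_real pi * \<i> * z)"
    by (simp add: exp_add)
  show ?thesis
    unfolding theta_term_def minus_i minus_nome
    by (simp only: qpow_def exp_power_int exp_add [symmetric] triangular, intro arg_cong[of _ _ exp])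
      (simp add: field_simps power2_eq_square)
qed

lemma jacobi_theta_product:
  assumes "Im \<tau> > 0"
  shows "jacobi_theta z \<tau> = - \<i> * qpow \<tau> (1 / 8) * exp (- (of_real pi * \<i> * z)) *
    (qpoch_inf (nome \<tau>) (nome \<tau>) * theta_prod (nome z) (nome \<tau>))"
proof -
  let ?C = "- \<i> * qpow \<tau> (1 / 8) * exp (- (of_real pi * \<i> * z))"
  have "jacobi_theta z \<tau> = (\<Sum>\<^sub>\<infinity>m. ?C * theta_term (nome \<tau>) (nome z) m)"
    unfolding jacobi_theta_def jacobi_theta_term
    by (rule infsum_reindex_bij_witness[of _ "\<lambda>m. m - 1" "\<lambda>n. n + 1"]) auto
  also have "\<dots> = ?C * (\<Sum>\<^sub>\<infinity>m. theta_term (nome \<tau>) (nome z) m)"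
    by (rule infsum_cmult_right')
  also have "(\<Sum>\<^sub>\<infinity>m. theta_term (nome \<tau>) (nome z) m) =
      qpoch_inf (nome \<tau>) (nome \<tau>) * theta_prod (nome z) (nome \<tau>)"
    by (intro infsumI jacobi_triple_product) (use norm_nome_less_one[OF assms] in auto)
  finally show ?thesis .
qed

lemma jacobi_theta_uminus:
  assumes "Im \<tau> > 0"
  shows "jacobi_theta (- z) \<tau> = - jacobi_theta z \<tau>"
proof -
  have nome_uminus: "nome (- z) = 1 / nome z"
    by (simp add: exp_minus field_simps)
  have exp_half: "exp (- (of_real pi * \<i> * - z)) / nome z = exp (- (of_real pi * \<i> * z))"
    unfolding exp_diff [symmetric] by (rule arg_cong[of _ _ exp]) simp
  have "theta_prod (nome (- z)) (nome \<tau>) = - theta_prod (nome z) (nome \<tau>) / nome z"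
    unfolding nome_uminus by (rule theta_prod_inverse) (use norm_nome_less_one[OF assms] in auto)
  then show ?thesis
    unfolding jacobi_theta_product[OF assms] exp_half[symmetric] by simp
qed

lemma g_fun_uminus:
  assumes "Im \<tau> > 0"
  shows "g_fun l (- z) \<tau> = (- 1) ^ l * g_fun l z \<tau>"
  by (cases "even l") (simp_all add: g_fun_def jacobi_theta_uminus[OF assms])

lemma dedekind_eta_cubed_over_jacobi_theta:
  assumes "Im \<tau> > 0"
  shows "dedekind_eta \<tau> ^ 3 / jacobi_theta z \<tau> =
    \<i> * qpoch_inf (nome \<tau>) (nome \<tau>) ^ 2 * exp (of_real pi * \<i> * z) / theta_prod (nome z) (nome \<tau>)"
proof -
  have qpow: "qpow \<tau> (1 / 24) ^ 3 = qpow \<tau> (1 / 8)" "qpow \<tau> (1 / 8) \<noteq> 0"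
    by (simp_all add: qpow_def exp_of_nat_mult [symmetric])
  have "qpoch_inf (nome \<tau>) (nome \<tau>) \<noteq> 0"
    using qpoch_inf_nonzero norm_nome_less_one[OF assms] by blast
  moreover have "Q * P ^ 3 / (- \<i> * Q * inverse e * (P * x)) = \<i> * P ^ 2 * e / x"
    if "Q \<noteq> 0" "P \<noteq> 0" "e \<noteq> 0" for Q P e x :: complex
    using that by (cases "x = 0") (simp_all add: field_simps power2_eq_square power3_eq_cube)
  ultimately show ?thesis
    unfolding jacobi_theta_product[OF assms] dedekind_eta_def power_mult_distrib qpow(1) exp_minus
    using qpow(2) exp_not_eq_zero by blast
qed

lemma g_fun_product:
  assumes "Im \<tau> > 0"
  shows "g_fun l z \<tau> = \<i> ^ l * qpoch_inf (nome \<tau>) (nome \<tau>) ^ (2 * l) *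
    exp (of_nat l * of_real pi * \<i> * z) / theta_prod (nome z) (nome \<tau>) ^ l"
proof -
  have "g_fun l z \<tau> = (dedekind_eta \<tau> ^ 3 / jacobi_theta z \<tau>) ^ l"
    by (simp add: g_fun_def power_mult power_divide)
  moreover have "exp (of_nat l * of_real pi * \<i> * z) = exp (of_real pi * \<i> * z) ^ l"
    by (simp add: exp_of_nat_mult [symmetric] mult_ac)
  ultimately show ?thesis
    by (simp only: dedekind_eta_cubed_over_jacobi_theta[OF assms] power_divide power_mult_distrib
        power_mult)
qed

lemma recip_theta_prod_power:
  assumes "Im \<tau> > 0"
  shows "1 / theta_prod (nome z) (nome \<tau>) ^ l =
    (- \<i>) ^ l / qpoch_inf (nome \<tau>) (nome \<tau>) ^ (2 * l) *
    (g_fun l z \<tau> * exp (- (of_nat l * of_real pi * \<i> * z)))"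
proof -
  have "qpoch_inf (nome \<tau>) (nome \<tau>) \<noteq> 0"
    using qpoch_inf_nonzero norm_nome_less_one[OF assms] by blast
  moreover have "(- \<i>) ^ l * \<i> ^ l = 1"
    by (simp flip: power_mult_distrib)
  moreover have "1 / X = K / P * (k * P * e / X * inverse e)"
    if "P \<noteq> 0" "K * k = 1" "e \<noteq> 0" for K k P e X :: complex
  proof -
    have "K / P * (k * P * e / X * inverse e) = K * k / X"
      using that(1,3) by simp
    with that(2) show ?thesis
      by simp
  qed
  ultimately show ?thesis
    unfolding g_fun_product[OF assms] exp_minus using exp_not_eq_zero power_not_zero by blast
qed

text \<open>The box is wider than one period, so that it is an open neighbourhood of the closed rectangle of
  width 1 around 0, but 0 is still the only zero of theta in it.\<close>

abbreviation period_box :: "complex \<Rightarrow> complex set" where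
  "period_box \<tau> \<equiv> box (Complex (- 1) (- Im \<tau>)) (Complex 1 (Im \<tau>))"

lemma zero_in_period_box: "Im \<tau> > 0 \<Longrightarrow> 0 \<in> period_box \<tau>"
  by (simp add: in_box_complex_iff)

lemma nome_eq_one_imp_zero:
  assumes "\<bar>Re z\<bar> < 1" "nome z = 1"
  shows "z = 0"
proof -
  from assms(2) obtain n :: int where period: "Im z = 0" "Re z = of_int n"
    by (auto simp: exp_eq_1)
  with assms(1) have "n = 0"
    by auto
  with period show ?thesis
    by (simp add: complex_eq_iff)
qed

lemma qpoch_inf_nome_nonzero:
  assumes "Im \<tau> > 0" "\<bar>Im z\<bar> < Im \<tau>"
  shows "qpoch_inf (nome z * nome \<tau>) (nome \<tau>) \<noteq> 0" "qpoch_inf (nome \<tau> / nome z) (nome \<tau>) \<noteq> 0"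
proof -
  have "norm (nome (z + \<tau>)) < 1" "norm (nome (\<tau> - z)) < 1"
    using assms(2) by (auto intro!: norm_nome_less_one)
  then have "norm (nome z * nome \<tau>) < 1" "norm (nome \<tau> / nome z) < 1"
    by (simp_all only: distrib_left right_diff_distrib exp_add exp_diff)
  then show "qpoch_inf (nome z * nome \<tau>) (nome \<tau>) \<noteq> 0" "qpoch_inf (nome \<tau> / nome z) (nome \<tau>) \<noteq> 0"
    using qpoch_inf_nonzero norm_nome_less_one[OF assms(1)] by blast+
qed

lemma theta_prod_nome_simple_zero:
  assumes "Im \<tau> > 0"
  obtains E where "E holomorphic_on period_box \<tau>" "\<And>z. z \<in> period_box \<tau> \<Longrightarrow> E z \<noteq> 0"
    "\<And>z. z \<in> period_box \<tau> \<Longrightarrow> theta_prod (nome z) (nome \<tau>) = z * E z"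
proof -
  let ?q = "nome \<tau>"
  note norm_q = norm_nome_less_one[OF assms]
  define slope where
    "slope z = (if z = 0 then deriv (\<lambda>z. 1 - nome z) 0
      else (1 - nome z - (1 - nome 0)) / (z - 0))" for z
  define E where "E z = slope z * qpoch_inf (nome z * ?q) ?q * qpoch_inf (?q / nome z) ?q" for z
  show ?thesis
  proof
    have "slope holomorphic_on period_box \<tau>"
      unfolding slope_def by (rule pole_lemma_open) (auto intro!: holomorphic_intros)
    then show "E holomorphic_on period_box \<tau>"
      unfolding E_def using norm_q by (intro holomorphic_intros) auto
  next
    fix z assume "z \<in> period_box \<tau>"
    then have bounds: "\<bar>Re z\<bar> < 1" "\<bar>Im z\<bar> < Im \<tau>"
      by (auto simp: in_box_complex_iff)
    have "deriv (\<lambda>z. 1 - nome z) 0 = - (2 * of_real pi * \<i>)"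
      by (rule DERIV_imp_deriv) (auto intro!: derivative_eq_intros)
    then have "slope z \<noteq> 0"
      using nome_eq_one_imp_zero[OF bounds(1)] by (auto simp: slope_def)
    then show "E z \<noteq> 0"
      using qpoch_inf_nome_nonzero[OF assms bounds(2)] by (simp add: E_def)
    show "theta_prod (nome z) ?q = z * E z"
      using qpoch_inf_rec[OF norm_q, of "nome z"] by (simp add: theta_prod_def E_def slope_def)
  qed
qed

lemma g_fun_pole:
  assumes "Im \<tau> > 0"
  obtains H where "H holomorphic_on period_box \<tau>"
    "\<And>z. z \<in> period_box \<tau> \<Longrightarrow> g_fun l z \<tau> = H z / z ^ l"
proof -
  obtain E where simple_zero: "E holomorphic_on period_box \<tau>" "\<And>z. z \<in> period_box \<tau> \<Longrightarrow> E z \<noteq> 0"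
    "\<And>z. z \<in> period_box \<tau> \<Longrightarrow> theta_prod (nome z) (nome \<tau>) = z * E z"
    using theta_prod_nome_simple_zero[OF assms] by blast
  let ?H = "\<lambda>z. \<i> ^ l * qpoch_inf (nome \<tau>) (nome \<tau>) ^ (2 * l) *
    exp (of_nat l * of_real pi * \<i> * z) / E z ^ l"
  show ?thesis
  proof (rule that)
    show "?H holomorphic_on period_box \<tau>"
      using simple_zero(1,2) by (intro holomorphic_intros) auto
    show "g_fun l z \<tau> = ?H z / z ^ l" if "z \<in> period_box \<tau>" for z
      using simple_zero(3)[OF that] by (simp add: g_fun_product[OF assms] power_mult_distrib)
  qed
qed

lemma holomorphic_on_g_fun:
  assumes "Im \<tau> > 0"
  shows "(\<lambda>z. g_fun l z \<tau>) holomorphic_on period_box \<tau> - {0}"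
proof -
  obtain H where pole: "H holomorphic_on period_box \<tau>"
    "\<And>z. z \<in> period_box \<tau> \<Longrightarrow> g_fun l z \<tau> = H z / z ^ l"
    using g_fun_pole[OF assms] by blast
  have "(\<lambda>z. H z / z ^ l) holomorphic_on period_box \<tau> - {0}"
    using pole(1) by (auto intro!: holomorphic_intros intro: holomorphic_on_subset)
  then show ?thesis
    by (rule holomorphic_transform) (simp add: pole(2))
qed

section \<open>The principal part at zero\<close>

lemma D_coeff_eqI:
  assumes "\<And>j. j \<notin> {1..l} \<Longrightarrow> D j = 0"
    and "(\<lambda>z. g_fun l z \<tau> - polar_part (2 * of_real pi * \<i>) l D z) \<in> O[at 0](\<lambda>_. 1)"
  shows "D_coeff l \<tau> = D"
  unfolding D_coeff_def polar_part_def[symmetric]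
  using assms by (intro the_equality conjI allI impI)
    (auto intro: polar_part_unique[where c = "2 * of_real pi * \<i>" and l = l and f = "\<lambda>z. g_fun l z \<tau>"])

lemma g_fun_principal_part:
  assumes "Im \<tau> > 0"
  obtains h where "h holomorphic_on period_box \<tau>"
    "\<And>z. z \<in> period_box \<tau> - {0} \<Longrightarrow>
      g_fun l z \<tau> = polar_part (2 * of_real pi * \<i>) l (D_coeff l \<tau>) z + h z"
    "\<And>j. j \<notin> {1..l} \<Longrightarrow> D_coeff l \<tau> j = 0"
proof -
  obtain H where pole: "H holomorphic_on period_box \<tau>"
    "\<And>z. z \<in> period_box \<tau> \<Longrightarrow> g_fun l z \<tau> = H z / z ^ l"
    using g_fun_pole[OF assms] by blast
  have two_pi_i_nonzero: "2 * of_real pi * \<i> \<noteq> 0"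
    by simp
  obtain D h where D_outside: "\<And>j. j \<notin> {1..l} \<Longrightarrow> D j = 0" and holo: "h holomorphic_on period_box \<tau>"
    and expansion: "\<And>z. z \<in> period_box \<tau> - {0} \<Longrightarrow>
      H z / z ^ l = polar_part (2 * of_real pi * \<i>) l D z + h z"
    using polar_part_exists[OF open_box pole(1) two_pi_i_nonzero] by blast
  have "D_coeff l \<tau> = D"
    using D_outside by (rule D_coeff_eqI)
      (use bigo_1_of_holomorphic_remainder[OF open_box zero_in_period_box[OF assms] holo]
        pole(2) expansion in auto)
  then show ?thesis
    using D_outside holo pole(2) expansion by (intro that[of h]) auto
qed

lemma D_coeff_parity:
  assumes "Im \<tau> > 0" and "j mod 2 \<noteq> l mod 2"
  shows "D_coeff l \<tau> j = 0"
proof -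
  let ?c = "2 * of_real pi * \<i>" and ?D = "D_coeff l \<tau>"
  have sign: "(- 1) ^ l * ((- 1) ^ l * x) = x" for x :: complex
    by (simp flip: power_mult_distrib mult.assoc)
  define E where "E = (\<lambda>j. (- 1) ^ l * ((- 1) ^ j * ?D j))"
  obtain h where remainder: "h holomorphic_on period_box \<tau>"
    "\<And>z. z \<in> period_box \<tau> - {0} \<Longrightarrow> g_fun l z \<tau> = polar_part ?c l ?D z + h z"
    and D_outside: "\<And>j. j \<notin> {1..l} \<Longrightarrow> ?D j = 0"
    using g_fun_principal_part[OF assms(1), of l] by blast
  have "(\<lambda>z. g_fun l z \<tau> - polar_part ?c l ?D z) \<in> O[at 0](\<lambda>_. 1)"
    using bigo_1_of_holomorphic_remainder[OF open_box zero_in_period_box[OF assms(1)] remainder] .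
  from bigo_uminus_at_0[OF this]
  have "(\<lambda>z. (- 1) ^ l * (g_fun l (- z) \<tau> - polar_part ?c l ?D (- z))) \<in> O[at 0](\<lambda>_. 1)"
    by simp
  also have "(\<lambda>z. (- 1) ^ l * (g_fun l (- z) \<tau> - polar_part ?c l ?D (- z))) =
      (\<lambda>z. g_fun l z \<tau> - polar_part ?c l E z)"
    by (simp add: g_fun_uminus[OF assms(1)] polar_part_uminus polar_part_cmult E_def right_diff_distrib
        sign)
  finally have "?D = E"
    by (intro D_coeff_eqI) (use D_outside in \<open>auto simp: E_def\<close>)
  then have "?D j = (- 1) ^ (l + j) * ?D j"
    unfolding E_def power_add mult.assoc by metis
  moreover have "odd (l + j)"
    using assms(2) by presburger
  ultimately show ?thesis
    by simp
qed

definition D_poly :: "nat \<Rightarrow> complex \<Rightarrow> real \<Rightarrow> complex" where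
  "D_poly l \<tau> x = (\<Sum>j | 1 \<le> j \<and> j \<le> l \<and> j mod 2 = l mod 2.
     D_coeff l \<tau> j / fact (j - 1) * of_real (x ^ (j - 1)))"

lemma residue_g_fun_exp:
  assumes "Im \<tau> > 0"
  shows "2 * of_real pi * \<i> * residue (\<lambda>z. g_fun l z \<tau> * exp (2 * of_real pi * \<i> * of_real x * z)) 0 =
    D_poly l \<tau> x"
proof -
  define c where "c = 2 * of_real pi * \<i>"
  have "c \<noteq> 0"
    by (simp add: c_def)
  obtain h where remainder: "h holomorphic_on period_box \<tau>"
    "\<And>z. z \<in> period_box \<tau> - {0} \<Longrightarrow> g_fun l z \<tau> = polar_part c l (D_coeff l \<tau>) z + h z"
    by (rule g_fun_principal_part[OF assms, of l, folded c_def]) (rule that)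
  have residue: "residue (\<lambda>z. g_fun l z \<tau> * exp (c * of_real x * z)) 0 =
      (\<Sum>j = 1..l. D_coeff l \<tau> j / c ^ j * ((c * of_real x) ^ (j - 1) / fact (j - 1)))"
    using open_box zero_in_period_box[OF assms] remainder(1) \<open>c \<noteq> 0\<close> remainder(2)
    by (rule residue_times_exp)
  have "c * residue (\<lambda>z. g_fun l z \<tau> * exp (c * of_real x * z)) 0 =
      (\<Sum>j = 1..l. c * (D_coeff l \<tau> j / c ^ j * ((c * of_real x) ^ (j - 1) / fact (j - 1))))"
    unfolding residue by (rule sum_distrib_left)
  also have "\<dots> = (\<Sum>j = 1..l. D_coeff l \<tau> j / fact (j - 1) * of_real (x ^ (j - 1)))"
  proof (rule sum.cong)
    fix j assume "j \<in> {1..l}"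
    then obtain i where "j = Suc i"
      by (cases j) auto
    then show "c * (D_coeff l \<tau> j / c ^ j * ((c * of_real x) ^ (j - 1) / fact (j - 1))) =
        D_coeff l \<tau> j / fact (j - 1) * of_real (x ^ (j - 1))"
      using \<open>c \<noteq> 0\<close> by (simp add: power_mult_distrib)
  qed simp
  also have "\<dots> = D_poly l \<tau> x"
    unfolding D_poly_def by (rule sum.mono_neutral_right) (use D_coeff_parity[OF assms] in auto)
  finally show ?thesis
    unfolding c_def .
qed

section \<open>The Laurent coefficients of reciprocal theta powers\<close>

definition recip_theta_coeff :: "nat \<Rightarrow> complex \<Rightarrow> int \<Rightarrow> complex" where
  "recip_theta_coeff l q = annulus_laurent_coeff (norm q) 1 (\<lambda>w. 1 / theta_prod w q ^ l)"

lemma recip_theta_laurent_series: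
  assumes "norm q < 1"
  shows "laurent_series_on (norm q) 1 (\<lambda>w. 1 / theta_prod w q ^ l) (recip_theta_coeff l q)"
proof -
  let ?f = "\<lambda>w. 1 / qpoch_inf w q ^ l"
  have "?f holomorphic_on ball 0 1"
    by (intro holomorphic_intros) (use assms qpoch_inf_nonzero in auto)
  then obtain a where "laurent_series_on (norm q / 1) 1 (\<lambda>w. ?f w * ?f (q / w)) a"
    using laurent_series_on_product zero_less_one by blast
  then have "laurent_series_on (norm q) 1 (\<lambda>w. 1 / theta_prod w q ^ l) a"
    by (simp add: theta_prod_def power_mult_distrib)
  then show ?thesis
    unfolding recip_theta_coeff_def using assms by (simp add: annulus_laurent_coeff_eqI)
qed

lemma recip_theta_laurent_series_outer:
  assumes "norm q < 1" "q \<noteq> 0"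
  shows "laurent_series_on 1 (1 / norm q) (\<lambda>w. 1 / theta_prod w q ^ l)
    (\<lambda>n. (- 1) ^ l * (q powi (n + int l) * recip_theta_coeff l q (n + int l)))"
proof (rule laurent_series_on_cong)
  have "laurent_series_on 1 (1 / norm q) (\<lambda>w. 1 / theta_prod (q * w) q ^ l)
      (\<lambda>n. q powi n * recip_theta_coeff l q n)"
    using laurent_series_on_dilate[OF recip_theta_laurent_series[OF assms(1)] assms(2)] assms(2)
    by simp
  then show "laurent_series_on 1 (1 / norm q) (\<lambda>w. (- 1) ^ l * (1 / theta_prod (q * w) q ^ l / w ^ l))
      (\<lambda>n. (- 1) ^ l * (q powi (n + int l) * recip_theta_coeff l q (n + int l)))"
    by (intro laurent_series_on_cmult laurent_series_on_divide_power) simp_all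
next
  fix w :: complex assume "1 < norm w"
  then have "w \<noteq> 0"
    by auto
  then have "theta_prod (q * w) q ^ l * w ^ l = (- 1) ^ l * theta_prod w q ^ l"
    by (simp add: theta_prod_shift[OF assms] flip: power_mult_distrib)
  then show "(- 1) ^ l * (1 / theta_prod (q * w) q ^ l / w ^ l) = 1 / theta_prod w q ^ l"
    by (cases "even l") simp_all
qed

lemma recip_theta_div_nome_powi:
  assumes "Im \<tau> > 0"
  shows "1 / theta_prod (nome z) (nome \<tau>) ^ l / nome z powi n =
    (- \<i>) ^ l / qpoch_inf (nome \<tau>) (nome \<tau>) ^ (2 * l) *
    (g_fun l z \<tau> * exp (2 * of_real pi * \<i> * of_real (- (of_int n + real l / 2)) * z))"
proof -
  have "exp (2 * of_real pi * \<i> * of_real (- (of_int n + real l / 2)) * z) =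
      exp (- (of_nat l * of_real pi * \<i> * z)) / nome z powi n"
    unfolding nome_powi exp_diff [symmetric]
    by (rule arg_cong[of _ _ exp]) (simp add: field_simps)
  then show ?thesis
    unfolding recip_theta_prod_power[OF assms] by simp
qed

lemma recip_theta_coeff_diff:
  fixes \<tau> :: complex
  defines "q \<equiv> nome \<tau>"
  assumes \<tau>: "Im \<tau> > 0"
  shows "(- 1) ^ l * (q powi (n + int l) * recip_theta_coeff l q (n + int l)) -
      recip_theta_coeff l q n =
    (- \<i>) ^ l / qpoch_inf q q ^ (2 * l) * D_poly l \<tau> (- (of_int n + real l / 2))"
proof -
  let ?x = "- (of_int n + real l / 2)" and ?y = "Im \<tau> / 2"
  let ?K = "(- \<i>) ^ l / qpoch_inf q q ^ (2 * l)"
  let ?G = "\<lambda>z. g_fun l z \<tau> * exp (2 * of_real pi * \<i> * of_real ?x * z)"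
  let ?F = "\<lambda>z. 1 / theta_prod (nome z) q ^ l / nome z powi n"
  have norm_q: "norm q < 1"
    using norm_nome_less_one[OF \<tau>] by (simp add: q_def)
  have F_eq: "?F = (\<lambda>z. ?K * ?G z)"
    unfolding q_def recip_theta_div_nome_powi[OF \<tau>] ..
  have holo: "?G holomorphic_on period_box \<tau> - {0}"
    by (intro holomorphic_intros holomorphic_on_g_fun \<tau>)
  have below: "(?F has_contour_integral
      (- 1) ^ l * (q powi (n + int l) * recip_theta_coeff l q (n + int l)))
      (linepath (Complex (- 1 / 2) (- ?y)) (Complex (- 1 / 2) (- ?y) + 1))"
    by (rule laurent_series_on_contour_integral[OF recip_theta_laurent_series_outer[OF norm_q]])
      (use \<tau> in \<open>auto simp: q_def norm_nome exp_minus field_simps\<close>)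
  have above: "(?F has_contour_integral recip_theta_coeff l q n)
      (linepath (Complex (- 1 / 2) ?y) (Complex (- 1 / 2) ?y + 1))"
    by (rule laurent_series_on_contour_integral[OF recip_theta_laurent_series[OF norm_q]])
      (use \<tau> in \<open>auto simp: q_def norm_nome\<close>)
  have "(- 1) ^ l * (q powi (n + int l) * recip_theta_coeff l q (n + int l)) - recip_theta_coeff l q n =
      2 * of_real pi * \<i> * (\<Sum>p\<in>{0}. residue ?F p)"
  proof (rule contour_integral_periodic_rectangle[where \<omega> = 1 and S = "period_box \<tau>"])
    show "?F holomorphic_on period_box \<tau> - {0}"
      unfolding F_eq by (intro holomorphic_intros holo)
    show "?F (z + of_real 1) = ?F z" for z
      unfolding of_real_1 nome_plus_one ..
  qed (use \<tau> below above in \<open>auto simp: in_box_complex_iff in_cbox_complex_iff convex_connected\<close>)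
  also have "(\<Sum>p\<in>{0}. residue ?F p) = residue ?F 0"
    by simp
  also have "\<dots> = ?K * residue ?G 0"
    unfolding F_eq by (rule residue_lmul[OF open_box zero_in_period_box[OF \<tau>] holo])
  finally show ?thesis
    using residue_g_fun_exp[OF \<tau>, of l ?x] by (simp add: mult.left_commute)
qed

lemma F_fun_eq_recip_theta_coeff:
  assumes "norm q < 1" "l \<ge> 1"
  shows "F_fun l s q = qpoch_inf q q ^ l\<^sup>2 * recip_theta_coeff l q (int s)"
proof -
  have "(\<lambda>w. qpoch_inf q q / (qpoch_inf w q ^ l * qpoch_inf (inverse w * q) q ^ l)) =
      (\<lambda>w. qpoch_inf q q * (1 / theta_prod w q ^ l))"
    by (simp add: theta_prod_def power_mult_distrib divide_inverse mult_ac)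
  then have "F_fun l s q = qpoch_inf q q ^ (l\<^sup>2 - 1) * (qpoch_inf q q * recip_theta_coeff l q (int s))"
    unfolding F_fun_def
    by (simp only: annulus_laurent_coeff_eqI[OF laurent_series_on_cmult norm_ge_zero assms(1),
          OF recip_theta_laurent_series[OF assms(1)]])
  then show ?thesis
    using assms(2) by (simp add: power_eq_if)
qed

section \<open>Partial theta series\<close>

definition partial_theta_term :: "nat \<Rightarrow> real \<Rightarrow> nat \<Rightarrow> complex \<Rightarrow> nat \<Rightarrow> complex" where
  "partial_theta_term l d k \<tau> n = (- 1) ^ (n * l) * of_real ((real l * real n + d) ^ k) *
     qpow \<tau> (1 / (2 * real l) * (real l * real n + d)\<^sup>2)"

lemma summable_partial_theta_term:
  assumes "Im \<tau> > 0" "l \<ge> 1"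
  shows "summable (partial_theta_term l d k \<tau>)"
proof (rule summable_norm_cancel, rule summable_comparison_test_bigo)
  have "(\<lambda>n. norm (exp (- real n))) = (\<lambda>n. exp (- 1) ^ n)"
    by (simp flip: exp_of_nat_mult)
  then show "summable (\<lambda>n. norm (exp (- real n)))"
    by (simp add: summable_geometric)
next
  define c where "c = pi * Im \<tau> / real l"
  have "c > 0" "real l > 0"
    using assms by (simp_all add: c_def)
  then have "(\<lambda>n. \<bar>real l * real n + d\<bar> ^ k * exp (- c * (real l * real n + d)\<^sup>2))
      \<in> O(\<lambda>n. exp (- real n))"
    by real_asymp
  also have "(\<lambda>n. \<bar>real l * real n + d\<bar> ^ k * exp (- c * (real l * real n + d)\<^sup>2)) =
      (\<lambda>n. norm (partial_theta_term l d k \<tau> n))"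
    by (simp add: partial_theta_term_def norm_mult norm_power norm_qpow c_def power_abs mult.assoc
        del: of_real_power of_real_add of_real_mult)
  finally show "(\<lambda>n. norm (partial_theta_term l d k \<tau> n)) \<in> O(\<lambda>n. exp (- real n))" .
qed

definition D_theta_term :: "nat \<Rightarrow> complex \<Rightarrow> real \<Rightarrow> nat \<Rightarrow> complex" where
  "D_theta_term l \<tau> d n = (- 1) ^ (n * l) *
     (qpow \<tau> (1 / (2 * real l) * (real l * real n + d)\<^sup>2) * D_poly l \<tau> (real l * real n + d))"

lemma D_theta_term_sums:
  assumes "Im \<tau> > 0" "l \<ge> 1"
  shows "D_theta_term l \<tau> d sums (\<Sum>j | 1 \<le> j \<and> j \<le> l \<and> j mod 2 = l mod 2.
    D_coeff l \<tau> j / fact (j - 1) * (\<Sum>n. partial_theta_term l d (j - 1) \<tau> n))"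
proof -
  have "D_theta_term l \<tau> d = (\<lambda>n. \<Sum>j | 1 \<le> j \<and> j \<le> l \<and> j mod 2 = l mod 2.
      D_coeff l \<tau> j / fact (j - 1) * partial_theta_term l d (j - 1) \<tau> n)"
    unfolding D_theta_term_def D_poly_def partial_theta_term_def sum_distrib_left
    by (intro ext sum.cong refl) (simp only: mult_ac)
  then show ?thesis
    by (simp only:) (intro sums_sum sums_mult summable_sums summable_partial_theta_term assms)
qed

text \<open>Completing the square: this weight turns the factor \<open>q^(n + l)\<close> of the difference equation
  into a mere sign.\<close>

definition weighted_theta_coeff :: "nat \<Rightarrow> complex \<Rightarrow> int \<Rightarrow> complex" where
  "weighted_theta_coeff l \<tau> n =
     qpow \<tau> ((of_int n + real l / 2)\<^sup>2 / (2 * real l)) * recip_theta_coeff l (nome \<tau>) n"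

lemma qpow_square_shift:
  assumes "l \<ge> 1"
  shows "qpow \<tau> ((of_int (n + int l) + real l / 2)\<^sup>2 / (2 * real l)) =
    qpow \<tau> ((of_int n + real l / 2)\<^sup>2 / (2 * real l)) * nome \<tau> powi (n + int l)"
  unfolding qpow_of_int[symmetric] qpow_add[symmetric] using assms
  by (intro arg_cong[of _ _ "qpow \<tau>"]) (simp add: field_simps power2_eq_square)

lemma weighted_theta_coeff_diff:
  assumes "Im \<tau> > 0" "l \<ge> 1" and centre: "of_int n + real l / 2 = - x"
  shows "(- 1) ^ l * weighted_theta_coeff l \<tau> (n + int l) - weighted_theta_coeff l \<tau> n =
    (- \<i>) ^ l / qpoch_inf (nome \<tau>) (nome \<tau>) ^ (2 * l) *
    (qpow \<tau> (1 / (2 * real l) * x\<^sup>2) * D_poly l \<tau> x)"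
proof -
  let ?a = "recip_theta_coeff l (nome \<tau>)"
  have "(- 1) ^ l * weighted_theta_coeff l \<tau> (n + int l) - weighted_theta_coeff l \<tau> n =
      qpow \<tau> ((of_int n + real l / 2)\<^sup>2 / (2 * real l)) *
      ((- 1) ^ l * (nome \<tau> powi (n + int l) * ?a (n + int l)) - ?a n)"
    unfolding weighted_theta_coeff_def qpow_square_shift[OF assms(2)]
    by (simp only: right_diff_distrib mult_ac)
  also note recip_theta_coeff_diff[OF assms(1)]
  finally show ?thesis
    unfolding centre by (simp add: mult_ac)
qed

lemma recip_theta_coeff_bounded_at_bot:
  assumes "norm q < 1"
  obtains C where "\<And>n. n \<le> m \<Longrightarrow> norm (recip_theta_coeff l q n) \<le> C"
proof -
  obtain \<rho> where \<rho>: "norm q < \<rho>" "\<rho> < 1"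
    using dense[OF assms] by blast
  have "\<rho> > 0"
    using \<rho>(1) norm_ge_zero[of q] by linarith
  obtain C where bound: "\<And>n. norm (recip_theta_coeff l q n) * \<rho> powi n \<le> C"
    using laurent_series_on_coeff_bounded[OF recip_theta_laurent_series[OF assms] \<rho> \<open>\<rho> > 0\<close>] by blast
  have "norm (recip_theta_coeff l q n) \<le> C / \<rho> powi m" if "n \<le> m" for n
  proof -
    have "\<rho> powi m \<le> \<rho> powi n"
      using \<rho> \<open>\<rho> > 0\<close> that by (intro power_int_decreasing) auto
    then have "norm (recip_theta_coeff l q n) * \<rho> powi m \<le> C"
      by (intro order_trans[OF mult_left_mono bound]) auto
    then show ?thesis
      using \<open>\<rho> > 0\<close> by (simp add: field_simps)
  qed
  then show ?thesis
    using that by blast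
qed

lemma weighted_theta_coeff_tendsto_0:
  assumes "Im \<tau> > 0" "l \<ge> 1"
  shows "(\<lambda>N. (- 1) ^ (N * l) * weighted_theta_coeff l \<tau> (m - int (N * l))) \<longlonglongrightarrow> 0"
proof -
  let ?a = "\<lambda>N. recip_theta_coeff l (nome \<tau>) (m - int (N * l))"
  let ?d = "- (of_int m + real l / 2)"
  obtain C where "\<And>n. n \<le> m \<Longrightarrow> norm (recip_theta_coeff l (nome \<tau>) n) \<le> C"
    using recip_theta_coeff_bounded_at_bot[OF norm_nome_less_one[OF assms(1)]] by blast
  then have "\<forall>\<^sub>F N in sequentially. norm (?a N) \<le> C"
    by simp
  then have "(\<lambda>N. partial_theta_term l ?d 0 \<tau> N * ?a N) \<longlonglongrightarrow> 0"
    using summable_LIMSEQ_zero[OF summable_partial_theta_term[OF assms]]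
    by (intro lim_null_mult_right_bounded)
  moreover have weight: "(of_int (m - int (N * l)) + real l / 2)\<^sup>2 / (2 * real l) =
      1 / (2 * real l) * (real l * real N + ?d)\<^sup>2" for N
    using assms(2) by (simp add: power2_eq_square field_simps)
  ultimately show ?thesis
    unfolding weighted_theta_coeff_def weight by (simp add: partial_theta_term_def mult.assoc)
qed

lemma weighted_theta_coeff_sums:
  assumes "Im \<tau> > 0" "l \<ge> 1"
  shows "(\<lambda>N. \<i> ^ l / qpoch_inf (nome \<tau>) (nome \<tau>) ^ (2 * l) *
      D_theta_term l \<tau> (real l / 2 - of_int m) N)
    sums weighted_theta_coeff l \<tau> m"
proof -
  let ?P = "qpoch_inf (nome \<tau>) (nome \<tau>) ^ (2 * l)"
  define b where "b N = weighted_theta_coeff l \<tau> (m - int (N * l))" for N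
  have telescoping: "(- 1) ^ (N * l) * b N - (- 1) ^ (Suc N * l) * b (Suc N) =
      \<i> ^ l / ?P * D_theta_term l \<tau> (real l / 2 - of_int m) N" for N
  proof -
    let ?n = "m - int (Suc N * l)" and ?x = "real l * real N + (real l / 2 - of_int m)"
    have "?n + int l = m - int (N * l)" "of_int ?n + real l / 2 = - ?x"
      by (simp_all add: algebra_simps)
    then have diff: "(- 1) ^ l * b N - b (Suc N) =
        (- \<i>) ^ l / ?P * (qpow \<tau> (1 / (2 * real l) * ?x\<^sup>2) * D_poly l \<tau> ?x)"
      unfolding b_def using weighted_theta_coeff_diff[OF assms, of ?n ?x] by (simp only:)
    have "(- 1) ^ (N * l) * b N - (- 1) ^ (Suc N * l) * b (Suc N) =
        (- 1) ^ (N * l) * ((- 1) ^ l * ((- 1) ^ l * b N - b (Suc N)))"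
      by (cases "even l") (simp_all add: power_add algebra_simps)
    also have "\<dots> = ((- 1) ^ l * (- \<i>) ^ l) / ?P * D_theta_term l \<tau> (real l / 2 - of_int m) N"
      unfolding diff D_theta_term_def by (simp add: mult_ac)
    also have "(- 1) ^ l * (- \<i>) ^ l = \<i> ^ l"
      by (simp flip: power_mult_distrib)
    finally show ?thesis .
  qed
  have "(\<lambda>N. (- 1) ^ (N * l) * b N) \<longlonglongrightarrow> 0"
    unfolding b_def using assms by (rule weighted_theta_coeff_tendsto_0)
  from telescope_sums'[OF this] show ?thesis
    unfolding telescoping by (simp add: b_def)
qed

lemma recip_theta_coeff_partial_theta:
  assumes "Im \<tau> > 0" "l \<ge> 1"
  shows "recip_theta_coeff l (nome \<tau>) (int s) =
    \<i> ^ l / qpoch_inf (nome \<tau>) (nome \<tau>) ^ (2 * l) * qpow \<tau> (- h_exp l s - real l / 8) *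
    (\<Sum>j | 1 \<le> j \<and> j \<le> l \<and> j mod 2 = l mod 2.
       D_coeff l \<tau> j / fact (j - 1) * (\<Sum>n. partial_theta_term l (real l / 2 - real s) (j - 1) \<tau> n))"
    (is "_ = ?K * _ * ?S")
proof -
  have "weighted_theta_coeff l \<tau> (int s) = ?K * ?S"
    using sums_unique2[OF weighted_theta_coeff_sums[OF assms] sums_mult[OF D_theta_term_sums[OF assms]],
        of "int s"] by simp
  moreover have "- h_exp l s - real l / 8 + (of_int (int s) + real l / 2)\<^sup>2 / (2 * real l) = 0"
    using assms(2) by (simp add: h_exp_def power2_eq_square field_simps)
  then have "qpow \<tau> (- h_exp l s - real l / 8) * weighted_theta_coeff l \<tau> (int s) =
      recip_theta_coeff l (nome \<tau>) (int s)"
    unfolding weighted_theta_coeff_def mult.assoc[symmetric] qpow_add[symmetric]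
    by (simp add: qpow_def)
  ultimately show ?thesis
    by (simp add: mult_ac)
qed

theorem theorem4p2:
  fixes l s :: nat and \<tau> :: complex
  assumes "l \<ge> 3" and "Im \<tau> > 0"
  shows "F_fun l s (nome \<tau>) =
    \<i> ^ l * qpoch_inf (nome \<tau>) (nome \<tau>) ^ (l\<^sup>2 - 2 * l) * qpow \<tau> (- h_exp l s - real l / 8) *
    (\<Sum>j | 1 \<le> j \<and> j \<le> l \<and> j mod 2 = l mod 2.
       D_coeff l \<tau> j / fact (j - 1) *
       (\<Sum>n. (- 1) ^ (n * l) *
          of_real ((real l * real n + real l / 2 - real s) ^ (j - 1)) *
          qpow \<tau> (1 / (2 * real l) * (real l * real n + real l / 2 - real s)\<^sup>2)))"
proof -
  let ?P = "qpoch_inf (nome \<tau>) (nome \<tau>)"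
  have l: "1 \<le> l" "2 * l \<le> l\<^sup>2" and norm_q: "norm (nome \<tau>) < 1"
    using assms norm_nome_less_one by (auto simp: power2_eq_square)
  have "?P \<noteq> 0"
    using norm_q norm_q by (rule qpoch_inf_nonzero)
  then have "?P ^ l\<^sup>2 * (\<i> ^ l / ?P ^ (2 * l)) = \<i> ^ l * ?P ^ (l\<^sup>2 - 2 * l)"
    using l(2) by (simp add: power_diff)
  then show ?thesis
    unfolding F_fun_eq_recip_theta_coeff[OF norm_q l(1)]
      recip_theta_coeff_partial_theta[OF assms(2) l(1)] partial_theta_term_def add_diff_eq
    by (simp only: mult.assoc[symmetric])
qed

end
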